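(* Let $v,w\ge 0$ be integers with $v+w\ge 5$ and $v$ even. (1) If $v\le 2w$, then $cost\ \mathscr{ON}(v+w,v;4,2)=cost\ \mathscr{ON}(v+w,4)$. (2) If $v\ge 2w+2$, then $$cost\ \mathscr{ON}(v+w,v;4,2)=\binom{v+w}{2}+\left\lceil \frac12\binom{v}{2}\right\rceil-\frac{vw}{2}+\delta,$$ where $\delta=1$ if $w=4$, or if $w=2$ and $v\equiv 0\pmod 4$, and $\delta=0$ otherwise.
   Context: Let $n\ge v\ge 0$ and let $C>C'\ge 1$ be integers. Let $X$ be a set of $n$ vertices, $K_n$ the complete graph on $X$, and $V\subseteq X$ a fixed subset with $|V|=v$; write $w=n-v$. A grooming $N(n,C)$ is a partition of the edge set $E(K_n)$ into (nonempty, not necessarily connected) subgraphs $B_1,\dots,B_\Lambda$ of $K_n$, without isolated vertices, such that $|E(B_k)|\le C$ for all $k$. A grooming $N(n,v;C,C')$ is an $N(n,C)$ in which, moreover, each $B_k$ contains at most $C'$ edges having both ends in $V$. The (drop) cost of a grooming is $\sum_{k=1}^{\Lambda}|V(B_k)|$. $\mathscr{ON}(n,C)$ (respectively $\mathscr{ON}(n,v;C,C')$) denotes a grooming $N(n,C)$ (respectively $N(n,v;C,C')$) of minimum cost, and $cost\ \mathscr{ON}(n,C)$ (respectively $cost\ \mathscr{ON}(n,v;C,C')$) denotes that minimum cost. *)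

theory Defs
  imports Complex_Main "HOL-Library.Disjoint_Sets" "HOL-Library.Ramsey"
begin

text \<open>
  An edge is a 2-element set of vertices, so the edge set of the complete graph on \<open>X\<close> is
  \<open>nsets X 2\<close>. A subgraph without isolated vertices is determined by its edge set, so a block \<open>B\<close>
  of a grooming is given by its edges, and its vertex set is \<open>\<Union>B\<close>. Recall that \<open>partition_on\<close>
  requires the blocks to be nonempty.
\<close>

type_synonym 'a block = "'a set set"

text \<open>\<open>N(n, C)\<close> on the vertex set \<open>X\<close>, where \<open>n = card X\<close>.\<close>

definition grooming :: "'a set \<Rightarrow> nat \<Rightarrow> 'a block set \<Rightarrow> bool" where
  "grooming X C P \<longleftrightarrow> partition_on (nsets X 2) P \<and> (\<forall>B\<in>P. card B \<le> C)"

text \<open>\<open>N(n, v; C, C')\<close> on the vertex set \<open>X\<close> with distinguished subset \<open>V\<close>, where \<open>v = card V\<close>.\<close>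

definition grooming2 :: "'a set \<Rightarrow> 'a set \<Rightarrow> nat \<Rightarrow> nat \<Rightarrow> 'a block set \<Rightarrow> bool" where
  "grooming2 X V C C' P \<longleftrightarrow> grooming X C P \<and> (\<forall>B\<in>P. card {e \<in> B. e \<subseteq> V} \<le> C')"

definition drop_cost :: "'a block set \<Rightarrow> nat" where
  "drop_cost P = (\<Sum>B\<in>P. card (\<Union>B))"

definition cost_ON :: "'a set \<Rightarrow> nat \<Rightarrow> nat" where
  "cost_ON X C = (LEAST c. \<exists>P. grooming X C P \<and> drop_cost P = c)"

definition cost_ON2 :: "'a set \<Rightarrow> 'a set \<Rightarrow> nat \<Rightarrow> nat \<Rightarrow> nat" where
  "cost_ON2 X V C C' = (LEAST c. \<exists>P. grooming2 X V C C' P \<and> drop_cost P = c)"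

text \<open>Groomings exist, so the two minima are attained.\<close>

lemma grooming2_exists:
  assumes "1 \<le> C" "1 \<le> C'"
  shows "\<exists>P. grooming2 X V C C' P"
proof
  have "card {e \<in> {d}. e \<subseteq> V} \<le> 1" for d :: "'a set"
    using card_mono[of "{d}" "{e \<in> {d}. e \<subseteq> V}"] by auto
  then show "grooming2 X V C C' ((\<lambda>e. {e}) ` nsets X 2)"
    using assms unfolding grooming2_def grooming_def
    by (auto simp: partition_on_def disjoint_def intro: order_trans)
qed

lemma cost_ON_attained:
  assumes "1 \<le> C"
  shows "\<exists>P. grooming X C P \<and> drop_cost P = cost_ON X C"
proof -
  obtain P where "grooming X C P"
    using grooming2_exists[OF assms order_refl] unfolding grooming2_def by blast
  then have "\<exists>c P. grooming X C P \<and> drop_cost P = c" by blast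
  then show ?thesis unfolding cost_ON_def by (rule LeastI_ex)
qed

lemma cost_ON2_attained:
  assumes "1 \<le> C" "1 \<le> C'"
  shows "\<exists>P. grooming2 X V C C' P \<and> drop_cost P = cost_ON2 X V C C'"
proof -
  have "\<exists>c P. grooming2 X V C C' P \<and> drop_cost P = c"
    using grooming2_exists[OF assms] by blast
  then show ?thesis unfolding cost_ON2_def by (rule LeastI_ex)
qed

end

theory Submission
  imports Defs
begin

text \<open>
  A block with at most four edges has at least as many vertices as edges, with equality exactly for
  the triangle, the 4-cycle and the triangle with a pendant edge. Hence only the excess of vertices
  over edges matters. If a block has \<open>a \<le> 2\<close> edges inside \<open>V\<close> and \<open>b\<close> edges between \<open>V\<close> and
  \<open>W = X - V\<close>, then its excess is at least \<open>(a - b) / 2\<close>, and summing gives the lower bound; the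
  correction \<open>\<delta>\<close> comes from the fact that tight blocks would have to decompose \<open>K\<^sub>2\<close> or \<open>K\<^sub>4\<close>
  on \<open>W\<close>.

  For the constructions, decompose \<open>K\<^sub>v\<close> into \<open>v - 1\<close> perfect matchings. All edges from a vertex
  \<open>z \<in> W\<close> to \<open>V\<close> together with one perfect matching form triangles, together with two perfect matchings
  they form triangles with pendant edges, and the edges from two vertices of \<open>W\<close> form 4-cycles, all
  without excess. If \<open>v \<le> 2w\<close>, every perfect matching can be absorbed in this way. If
  \<open>v \<ge> 2w + 2\<close>, the remaining matchings are paired into paths with two edges of excess one; as their
  number is odd, three matchings that form a Hamiltonian cycle with chords are treated together.
\<close>

section \<open>Packings of edge sets and their excess\<close>

text \<open>Each vertex of \<open>W\<close> absorbs at most two of the \<open>2k - 1\<close>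
  matchings, where \<open>v = 2k\<close>; the two cases of the theorem are separated by whether
  \<open>2w\<close> reaches that number. In the second case, twice the excess minus its bound has
  the parity of \<open>k\<close>, and this is what the ceiling rounds. A single matching left over
  would be expensive: its edges are disjoint, so no two of them form a path. It is replaced by one
  half of a Hamiltonian cycle, a path with \<open>k\<close> edges, while the edges of the other half
  are shared out among the chords. This needs three factors of a particular shape, hence an explicit
  one-factorization instead of an arbitrary one. \<open>K_2\<close> and \<open>K_4\<close> are the
  only complete graphs without a decomposition of excess zero. If \<open>v <= 2w\<close>, some
  vertex of \<open>W\<close> absorbs one matching only, and its triangles have room for one or two
  edges of \<open>W\<close> as pendants. If \<open>v >= 2w + 2\<close>, no block takes an edge of
  \<open>W\<close> for free, except that for odd \<open>k\<close> the rounding leaves room for a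
  single edge: enough for \<open>K_2\<close>, not for \<open>K_4\<close>.\<close>

text \<open>
  \<open>e\<close> bounds the excess of the cost over the number of edges.
\<close>

definition pack :: "'a set \<Rightarrow> 'a set set \<Rightarrow> nat \<Rightarrow> bool" where
  "pack V E e \<longleftrightarrow> finite E \<and> (\<exists>P. partition_on E P \<and>
     (\<forall>B\<in>P. card B \<le> 4 \<and> card {x \<in> B. x \<subseteq> V} \<le> 2) \<and> drop_cost P \<le> card E + e)"

lemma pack_empty [simp]: "pack V {} 0"
  by (auto simp: pack_def partition_on_def drop_cost_def intro!: exI[of _ "{}"])

lemma pack_mono: "pack V E e \<Longrightarrow> e \<le> e' \<Longrightarrow> pack V E e'"
  unfolding pack_def by (meson add_left_mono le_trans)

lemma pack_block:
  assumes "finite B" "card B \<le> 4" "card {x \<in> B. x \<subseteq> V} \<le> 2" "card (\<Union>B) \<le> card B + e"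
  shows "pack V B e"
proof (cases "B = {}")
  case True
  then show ?thesis using pack_mono[OF pack_empty] by auto
next
  case False
  then show ?thesis using assms
    unfolding pack_def by (auto simp: partition_on_def drop_cost_def disjoint_def intro!: exI[of _ "{B}"])
qed

lemma pack_Un:
  assumes "pack V E e" "pack V E' e'" "E \<inter> E' = {}"
  shows "pack V (E \<union> E') (e + e')"
proof -
  obtain P where P: "partition_on E P" "\<forall>B\<in>P. card B \<le> 4 \<and> card {x \<in> B. x \<subseteq> V} \<le> 2"
    "drop_cost P \<le> card E + e" and fE: "finite E" using assms(1) unfolding pack_def by blast
  obtain Q where Q: "partition_on E' Q" "\<forall>B\<in>Q. card B \<le> 4 \<and> card {x \<in> B. x \<subseteq> V} \<le> 2"
    "drop_cost Q \<le> card E' + e'" and fE': "finite E'" using assms(2) unfolding pack_def by blast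
  have fin: "finite P" "finite Q"
    using fE fE' finite_elements[OF _ P(1)] finite_elements[OF _ Q(1)] by auto
  have part: "partition_on (E \<union> E') (P \<union> Q)"
  proof (rule partition_onI)
    show "\<Union>(P \<union> Q) = E \<union> E'" "{} \<notin> P \<union> Q"
      using P(1) Q(1) by (simp_all add: partition_on_def)
    fix p q assume pq: "p \<in> P \<union> Q" "q \<in> P \<union> Q" "p \<noteq> q"
    have cross: "disjnt p q" if "p \<in> P" "q \<in> Q" for p q
      using that partition_onD1[OF P(1)] partition_onD1[OF Q(1)] assms(3) by (auto simp: disjnt_iff)
    show "disjnt p q"
      using pq cross[of p q] cross[of q p] pairwiseD[OF partition_onD2[OF P(1)], of p q]
        pairwiseD[OF partition_onD2[OF Q(1)], of p q]
      by (auto simp: disjnt_sym)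
  qed
  \<comment> \<open>Only an inequality is needed, so common blocks of \<open>P\<close> and
    \<open>Q\<close> need not be excluded.\<close>
  have "drop_cost (P \<union> Q) \<le> drop_cost P + drop_cost Q"
    unfolding drop_cost_def using sum.union_inter[OF fin, of "\<lambda>B. card (\<Union>B)"] by linarith
  also have "\<dots> \<le> card (E \<union> E') + (e + e')"
    using P(3) Q(3) by (simp add: card_Un_disjoint[OF fE fE' assms(3)])
  finally show ?thesis
    unfolding pack_def using fE fE' part P(2) Q(2) by (intro conjI exI[of _ "P \<union> Q"]) (simp_all add: ball_Un)
qed

lemma pack_UN:
  assumes "finite I" "\<And>i. i \<in> I \<Longrightarrow> pack V (E i) (e i)"
    "\<And>i j. i \<in> I \<Longrightarrow> j \<in> I \<Longrightarrow> i \<noteq> j \<Longrightarrow> E i \<inter> E j = {}"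
  shows "pack V (\<Union>i\<in>I. E i) (\<Sum>i\<in>I. e i)"
  using assms
proof (induction I rule: finite_induct)
  case (insert i I)
  have "E i \<inter> (\<Union>j\<in>I. E j) = {}" using insert.hyps(2) insert.prems(2)[of i] by blast
  then show ?case
    using pack_Un[of V "E i" "e i" "\<Union>j\<in>I. E j" "\<Sum>j\<in>I. e j"] insert by simp
qed auto

text \<open>For the empty distinguished set the bound on inner edges is vacuous, so
  \<open>pack {}\<close> is the packing notion that belongs to groomings without a restriction on
  \<open>V\<close>.\<close>

lemma pack_restrict:
  assumes "pack {} E e" "card {x \<in> E. x \<subseteq> V} \<le> 2"
  shows "pack V E e"
proof -
  obtain P where P: "partition_on E P" "\<forall>B\<in>P. card B \<le> 4"
    "drop_cost P \<le> card E + e" and fE: "finite E" using assms(1) unfolding pack_def by blast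
  have "card {x \<in> B. x \<subseteq> V} \<le> 2" if "B \<in> P" for B
    using that P(1) fE assms(2)
    by (intro order_trans[OF card_mono assms(2)]) (auto simp: partition_on_def)
  then show ?thesis unfolding pack_def using P fE by blast
qed

lemma pack_subset:
  assumes "pack V E e" "V' \<subseteq> V"
  shows "pack V' E e"
proof -
  obtain P where P: "partition_on E P" "\<forall>B\<in>P. card B \<le> 4 \<and> card {x \<in> B. x \<subseteq> V} \<le> 2"
    "drop_cost P \<le> card E + e" and fE: "finite E" using assms(1) unfolding pack_def by blast
  have "card {x \<in> B. x \<subseteq> V'} \<le> 2" if "B \<in> P" for B
  proof -
    have "finite B" using that P(1) fE by (auto simp: partition_on_def intro: finite_subset)
    then have "card {x \<in> B. x \<subseteq> V'} \<le> card {x \<in> B. x \<subseteq> V}"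
      using assms(2) by (intro card_mono) auto
    then show ?thesis using P(2) that by fastforce
  qed
  then show ?thesis unfolding pack_def using P fE by blast
qed

section \<open>Stars and the elementary blocks of small excess\<close>

definition star :: "'a \<Rightarrow> 'a set \<Rightarrow> 'a set set" where
  "star z S = (\<lambda>x. {z, x}) ` S"

lemma star_empty [simp]: "star z {} = {}"
  by (simp add: star_def)

lemma star_insert [simp]: "star z (insert x S) = insert {z, x} (star z S)"
  by (simp add: star_def)

lemma star_Un: "star z (S \<union> T) = star z S \<union> star z T"
  by (auto simp: star_def)

lemma star_UN: "star z (\<Union>(a ` I)) = (\<Union>i\<in>I. star z (a i))"
  by (simp add: star_def image_UN)

lemma card2_obtain:
  assumes "card e = 2"
  obtains x y where "e = {x, y}" "x \<noteq> y"
  using assms by (auto simp: card_2_iff)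

lemma card2_meet_obtain:
  assumes "card e = 2" "card g = 2" "e \<noteq> g" "e \<inter> g \<noteq> {}"
  obtains x y y' where "e = {x, y}" "g = {x, y'}" "x \<noteq> y" "x \<noteq> y'" "y \<noteq> y'"
proof -
  obtain x where x: "x \<in> e" "x \<in> g" using assms(4) by blast
  obtain y where "e = {x, y}" "x \<noteq> y" using assms(1) x(1) by (auto simp: card_2_iff)
  moreover obtain y' where "g = {x, y'}" "x \<noteq> y'" using assms(2) x(2) by (auto simp: card_2_iff)
  ultimately show ?thesis using assms(3) that by blast
qed

lemma pack_edge:
  assumes "card e = 2" shows "pack V {e} 1"
proof (rule pack_block)
  have "card {x \<in> {e}. x \<subseteq> V} \<le> card {e}" by (rule card_mono) auto
  then show "card {x \<in> {e}. x \<subseteq> V} \<le> 2" by simp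
qed (use assms in auto)

lemma card_le_2_if_subset_pair: "S \<subseteq> {a, b} \<Longrightarrow> card S \<le> 2"
  using card_mono[of "{a, b}" S] by (auto intro: order_trans simp: card_insert_if)

lemma pack_path3:
  assumes "card e = 2" "card g = 2" "e \<noteq> g" "e \<inter> g \<noteq> {}"
  shows "pack V {e, g} 1"
proof -
  obtain x y y' where *: "e = {x, y}" "g = {x, y'}" "x \<noteq> y" "x \<noteq> y'" "y \<noteq> y'"
    using card2_meet_obtain[OF assms] .
  have "card (\<Union>{e, g}) \<le> 3" unfolding * by (simp add: card_insert_if)
  then show ?thesis
    using assms(3) by (intro pack_block card_le_2_if_subset_pair[of _ e g]) auto
qed

text \<open>The block is the triangle on \<open>z\<close> and \<open>e\<close> with \<open>g\<close>
  hanging from a vertex of \<open>e\<close>. With both \<open>e\<close> and \<open>g\<close> inside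
  \<open>V\<close> it uses the full allowance of two inner edges and still has as many edges as
  vertices.\<close>

lemma pack_paw:
  assumes "card e = 2" "card g = 2" "e \<noteq> g" "e \<inter> g \<noteq> {}" "z \<notin> e" "z \<notin> g" "z \<notin> V"
  shows "pack V (star z e \<union> {e, g}) 0"
proof -
  obtain x y y' where *: "e = {x, y}" "g = {x, y'}" "x \<noteq> y" "x \<noteq> y'" "y \<noteq> y'"
    using card2_meet_obtain[OF assms(1-4)] .
  have B: "star z e \<union> {e, g} = {{z, x}, {z, y}, {x, y}, {x, y'}}"
    unfolding * by (auto simp: star_def)
  have c: "card (star z e \<union> {e, g}) = 4" 
    unfolding B using * assms(5,6) by (simp add: doubleton_eq_iff card_insert_if)
  have u: "card (\<Union>(star z e \<union> {e, g})) \<le> 4"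
    unfolding B by (simp add: card_insert_if)
  show ?thesis
    using c u assms(7) by (intro pack_block card_le_2_if_subset_pair[of _ e g]) (auto simp: star_def *)
qed

lemma pack_triangle:
  assumes "card e = 2" "z \<notin> e" "z \<notin> V"
  shows "pack V (star z e \<union> {e}) 0"
proof -
  obtain x y where *: "e = {x, y}" "x \<noteq> y" using card2_obtain[OF assms(1)] .
  have B: "star z e \<union> {e} = {{z, x}, {z, y}, {x, y}}"
    unfolding * by (auto simp: star_def)
  have c: "card (star z e \<union> {e}) = 3" 
    unfolding B using * assms by (simp add: doubleton_eq_iff card_insert_if)
  have u: "card (\<Union>(star z e \<union> {e})) \<le> 3"
    unfolding B by (simp add: card_insert_if)
  show ?thesis
    using c u assms(3) by (intro pack_block card_le_2_if_subset_pair[of _ e e]) (auto simp: star_def *)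
qed

text \<open>In contrast to \<open>pack_paw\<close>, the pendant edge hangs from \<open>z\<close>,
  outside \<open>V\<close>. The fourth place of the block can thus be given to an edge of
  \<open>W\<close>.\<close>

lemma pack_triangle_pendant:
  assumes "card e = 2" "z \<notin> e" "z \<notin> V" "u \<notin> e" "u \<noteq> z"
  shows "pack V (star z e \<union> {e, {z, u}}) 0"
proof -
  obtain x y where *: "e = {x, y}" "x \<noteq> y" using card2_obtain[OF assms(1)] .
  have B: "star z e \<union> {e, {z, u}} = {{z, x}, {z, y}, {x, y}, {z, u}}"
    unfolding * by (auto simp: star_def)
  have "z \<noteq> x" "z \<noteq> y" "u \<noteq> x" "u \<noteq> y"
    using * assms by auto
  then have c: "card (star z e \<union> {e, {z, u}}) = 4"
    unfolding B using *(2) assms(5) by (simp add: doubleton_eq_iff card_insert_if)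
  have u: "card (\<Union>(star z e \<union> {e, {z, u}})) \<le> 4"
    unfolding B by (simp add: card_insert_if)
  show ?thesis
    using c u assms(3) by (intro pack_block card_le_2_if_subset_pair[of _ e e]) (auto simp: star_def *)
qed

lemma pack_4_cycle:
  assumes "card e = 2" "z \<notin> e" "z' \<notin> e" "z \<noteq> z'" "z \<notin> V" "z' \<notin> V"
  shows "pack V (star z e \<union> star z' e) 0"
proof -
  obtain x y where *: "e = {x, y}" "x \<noteq> y" using card2_obtain[OF assms(1)] .
  have B: "star z e \<union> star z' e = {{z, x}, {z, y}, {z', x}, {z', y}}"
    unfolding * by (auto simp: star_def)
  have c: "card (star z e \<union> star z' e) = 4" 
    unfolding B using * assms by (simp add: doubleton_eq_iff card_insert_if)
  have u: "card (\<Union>(star z e \<union> star z' e)) \<le> 4"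
    unfolding B by (simp add: card_insert_if)
  show ?thesis
    using c u assms(5,6) by (intro pack_block card_le_2_if_subset_pair[of _ e e]) (auto simp: star_def *)
qed

lemma pack_path3_family:
  assumes "finite I" "inj_on a I" "inj_on g I" "a ` I \<inter> g ` I = {}"
    "\<And>i. i \<in> I \<Longrightarrow> card (a i) = 2 \<and> card (g i) = 2 \<and> a i \<inter> g i \<noteq> {}"
  shows "pack V (a ` I \<union> g ` I) (card I)"
proof -
  have "pack V (\<Union>i\<in>I. {a i, g i}) (\<Sum>i\<in>I. 1)"
  proof (rule pack_UN[OF assms(1)])
    fix i assume i: "i \<in> I"
    then have "a i \<noteq> g i" using assms(4) by blast
    then show "pack V {a i, g i} 1" using assms(5)[OF i] by (intro pack_path3) auto
  next
    fix i j assume "i \<in> I" "j \<in> I" "i \<noteq> j"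
    then have "a i \<noteq> a j" "g i \<noteq> g j" "a i \<noteq> g j" "g i \<noteq> a j"
      using assms(4) by (blast dest: inj_onD[OF assms(2)] inj_onD[OF assms(3)])+
    then show "{a i, g i} \<inter> {a j, g j} = {}" by simp
  qed
  moreover have "(\<Union>i\<in>I. {a i, g i}) = a ` I \<union> g ` I" by auto
  ultimately show ?thesis by simp
qed

lemma star_disjoint:
  assumes "z \<notin> S" "z \<notin> T" "S \<inter> T = {}"
  shows "star z S \<inter> star z T = {}"
  using assms by (auto simp: star_def doubleton_eq_iff)

text \<open>The bases \<open>a i\<close> of the triangles determine which edges at \<open>z\<close>
  are used, so they must be pairwise disjoint as vertex sets; the pendants \<open>g i\<close> only
  have to be different edges.\<close>

lemma pack_paw_family:
  assumes "finite I" "inj_on a I" "inj_on g I" "a ` I \<inter> g ` I = {}" "z \<notin> V"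
    "\<And>i. i \<in> I \<Longrightarrow> card (a i) = 2 \<and> card (g i) = 2 \<and> a i \<inter> g i \<noteq> {} \<and> a i \<subseteq> V \<and> g i \<subseteq> V"
    "\<And>i j. i \<in> I \<Longrightarrow> j \<in> I \<Longrightarrow> i \<noteq> j \<Longrightarrow> a i \<inter> a j = {}"
  shows "pack V (star z (\<Union>(a ` I)) \<union> a ` I \<union> g ` I) 0"
proof -
  have "pack V (\<Union>i\<in>I. star z (a i) \<union> {a i, g i}) (\<Sum>i\<in>I. 0)"
  proof (rule pack_UN[OF assms(1)])
    fix i assume i: "i \<in> I"
    then have "a i \<noteq> g i" using assms(4) by blast
    then show "pack V (star z (a i) \<union> {a i, g i}) 0" 
      using assms(5) assms(6)[OF i] by (intro pack_paw) auto
  next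
    fix i j assume ij: "i \<in> I" "j \<in> I" "i \<noteq> j"
    have "a i \<noteq> a j" "g i \<noteq> g j" "a i \<noteq> g j" "g i \<noteq> a j"
      using assms(4) ij by (blast dest: inj_onD[OF assms(2)] inj_onD[OF assms(3)])+
    then have 1: "{a i, g i} \<inter> {a j, g j} = {}" by simp
    have 2: "star z (a i) \<inter> star z (a j) = {}"
      using assms(5) assms(6)[OF ij(1)] assms(6)[OF ij(2)] assms(7)[OF ij] by (intro star_disjoint) auto
    have 3: "star z S \<inter> {a l, g l} = {}" if "l \<in> I" for S l
      using assms(5) assms(6)[OF that] by (auto simp: star_def)
    have "{a i, g i} \<inter> star z (a j) = {}"
      using 3[OF ij(1)] by (simp only: Int_commute)
    then show "(star z (a i) \<union> {a i, g i}) \<inter> (star z (a j) \<union> {a j, g j}) = {}"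
      by (simp only: Int_Un_distrib Int_Un_distrib2 1 2 3[OF ij(2)] Un_empty_left)
  qed
  moreover have "(\<Union>i\<in>I. star z (a i) \<union> {a i, g i}) = star z (\<Union>(a ` I)) \<union> a ` I \<union> g ` I"
    unfolding star_UN by blast
  ultimately show ?thesis by simp
qed

section \<open>Perfect matchings\<close>

definition involution_on :: "'a set \<Rightarrow> ('a \<Rightarrow> 'a) \<Rightarrow> bool" where
  "involution_on V n \<longleftrightarrow> (\<forall>x\<in>V. n x \<in> V \<and> n x \<noteq> x \<and> n (n x) = x)"

lemma involution_on_Diff:
  assumes "involution_on V n" "x \<in> V"
  shows "involution_on (V - {x, n x}) n"
  unfolding involution_on_def
proof
  note n = assms(1)[unfolded involution_on_def, rule_format]
  fix z assume z: "z \<in> V - {x, n x}"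
  then have "n z \<noteq> x" "n z \<noteq> n x" using n[of z] n[OF assms(2)] by (metis Diff_iff insertCI)+
  then show "n z \<in> V - {x, n x} \<and> n z \<noteq> z \<and> n (n z) = z" using n[of z] z by simp
qed

text \<open>With a partner function as witness, deleting a pair and joining two other vertices
  become restriction and function update.\<close>

definition perfect_matching :: "'a set \<Rightarrow> 'a set set \<Rightarrow> bool" where
  "perfect_matching V F \<longleftrightarrow> (\<exists>n. involution_on V n \<and> F = (\<lambda>x. {x, n x}) ` V)"

lemma perfect_matching_edge:
  assumes "perfect_matching V F" "e \<in> F"
  shows "card e = 2" "e \<subseteq> V"
  using assms by (auto simp: perfect_matching_def involution_on_def)

lemma perfect_matching_Union:
  "perfect_matching V F \<Longrightarrow> \<Union>F = V"
  by (auto simp: perfect_matching_def involution_on_def)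

lemma perfect_matching_disjoint:
  assumes "perfect_matching V F" "e \<in> F" "e' \<in> F" "e \<noteq> e'"
  shows "e \<inter> e' = {}"
proof -
  obtain n where n: "involution_on V n" "F = (\<lambda>x. {x, n x}) ` V"
    using assms(1) by (auto simp: perfect_matching_def)
  have *: "e = {z, n z}" if "z \<in> e" "e \<in> F" for z e
    using that n by (auto simp: involution_on_def)
  have False if "z \<in> e" "z \<in> e'" for z
    using *[OF that(1) assms(2)] *[OF that(2) assms(3)] assms(4) by simp
  then show ?thesis by blast
qed

lemma perfect_matching_finite:
  "finite V \<Longrightarrow> perfect_matching V F \<Longrightarrow> finite F"
  by (auto simp: perfect_matching_def)

lemma perfect_matching_card:
  assumes "finite V" "perfect_matching V F"
  shows "card V = 2 * card F"
proof -
  have "card (\<Union>F) = (\<Sum>e\<in>F. card e)"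
    using assms perfect_matching_disjoint[OF assms(2)] perfect_matching_edge[OF assms(2)]
    by (intro card_Union_disjoint) (auto simp: pairwise_def disjnt_def intro: card_ge_0_finite)
  also have "\<dots> = (\<Sum>e\<in>F. 2)"
    using perfect_matching_edge[OF assms(2)] by (intro sum.cong) auto
  finally show ?thesis using perfect_matching_Union[OF assms(2)] by simp
qed

definition matchings :: "'a set \<Rightarrow> 'a set set set \<Rightarrow> bool" where
  "matchings V \<F> \<longleftrightarrow> finite \<F> \<and> (\<forall>F\<in>\<F>. perfect_matching V F) \<and> pairwise disjnt \<F>"

lemma exists_perfect_matching:
  assumes "finite V" "even (card V)"
  shows "\<exists>F. perfect_matching V F"
  using assms
proof (induction "card V" arbitrary: V rule: less_induct)
  case less
  show ?case
  proof (cases "V = {}")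
    case True
    then show ?thesis by (auto simp: perfect_matching_def involution_on_def)
  next
    case False
    have "2 \<le> card V" using False less.prems by (metis One_nat_def card_0_eq dvd_1_iff_1
        even_numeral less_2_cases_iff not_le odd_one)
    then obtain e where "e \<subseteq> V" "card e = 2" using obtain_subset_with_card_n by metis
    then obtain x y where xy: "x \<in> V" "y \<in> V" "x \<noteq> y" by (auto simp: card_2_iff)
    have "card (V - {x, y}) = card V - 2" using xy less.prems(1) by (simp add: card_Diff_subset)
    then obtain F where "perfect_matching (V - {x, y}) F"
      using less.hyps[of "V - {x, y}"] less.prems \<open>2 \<le> card V\<close> by auto
    then obtain n where n: "involution_on (V - {x, y}) n" by (auto simp: perfect_matching_def)
    have "involution_on V (n(x := y, y := x))"
      using n xy unfolding involution_on_def by auto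
    then show ?thesis unfolding perfect_matching_def by blast
  qed
qed

text \<open>
  Two perfect matchings form a bipartite graph: delete an edge \<open>{x, m x}\<close> and join the
  \<open>n\<close>-partners of its two ends.
\<close>

lemma two_involutions_colouring:
  assumes "finite V" "involution_on V m" "involution_on V n"
  shows "\<exists>R. \<forall>x\<in>V. (x \<in> R \<longleftrightarrow> m x \<notin> R) \<and> (x \<in> R \<longleftrightarrow> n x \<notin> R)"
  using assms
proof (induction V arbitrary: n rule: finite_psubset_induct)
  case (psubset V)
  note m = psubset.prems(1)[unfolded involution_on_def, rule_format]
  note n = psubset.prems(2)[unfolded involution_on_def, rule_format]
  show ?case
  proof (cases "V = {}")
    case False
    then obtain x where x: "x \<in> V" by blast
    define y where "y = m x"
    have y: "y \<in> V" "y \<noteq> x" "m y = x" using m[OF x] by (auto simp: y_def)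
    define V' where "V' = V - {x, y}"
    have V': "V' \<subset> V" using x by (auto simp: V'_def)
    have mV': "involution_on V' m"
      unfolding V'_def y_def using involution_on_Diff[OF psubset.prems(1) x] .
    show ?thesis
    proof (cases "n x = y")
      case True
      then have ny: "n y = x" using n x by auto
      have nV': "involution_on V' n"
        unfolding V'_def True[symmetric] using involution_on_Diff[OF psubset.prems(2) x] .
      obtain R where "\<forall>z\<in>V'. (z \<in> R \<longleftrightarrow> m z \<notin> R) \<and> (z \<in> R \<longleftrightarrow> n z \<notin> R)"
        using psubset.IH[OF V' mV' nV'] ..
      note R = this[rule_format]
      have out: "m z \<in> V'" "n z \<in> V'" if "z \<in> V'" for z
        using mV' nV' that unfolding involution_on_def by blast+
      show ?thesis
      proof (intro exI[of _ "insert x (R - {y})"] ballI)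
        fix z assume "z \<in> V"
        then consider "z = x" | "z = y" | "z \<in> V'" by (auto simp: V'_def)
        then show "(z \<in> insert x (R - {y}) \<longleftrightarrow> m z \<notin> insert x (R - {y})) \<and>
            (z \<in> insert x (R - {y}) \<longleftrightarrow> n z \<notin> insert x (R - {y}))"
        proof cases
          case 3
          then show ?thesis using R[OF 3] out[OF 3] by (auto simp: V'_def)
        qed (use y True ny y_def in auto)
      qed
    next
      case False
      define x' where "x' = n x"
      define y' where "y' = n y"
      have x': "x' \<in> V'" "n x' = x" using n[OF x] False by (auto simp: V'_def x'_def)
      have y': "y' \<in> V'" "n y' = y" using n[OF y(1)] n[OF x] False by (auto simp: V'_def y'_def)
      have ne: "x' \<noteq> y'" using x' y' y by auto
      define n' where "n' = n(x' := y', y' := x')"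
      have nV: "n z \<in> V' - {x', y'}" if "z \<in> V' - {x', y'}" for z
        using n[of z] x' y' that by (auto simp: V'_def x'_def y'_def)
      have nV': "involution_on V' n'"
        unfolding involution_on_def
      proof
        fix z assume z: "z \<in> V'"
        then consider "z = x'" | "z = y'" | "z \<in> V' - {x', y'}" by blast
        then show "n' z \<in> V' \<and> n' z \<noteq> z \<and> n' (n' z) = z"
        proof cases
          case 3
          then have "n' z = n z" "n' (n z) = n (n z)" using nV[OF 3] by (auto simp: n'_def)
          then show ?thesis using nV[OF 3] n[of z] z by (auto simp: V'_def)
        qed (use x' y' ne in \<open>auto simp: n'_def\<close>)
      qed
      obtain R where "\<forall>z\<in>V'. (z \<in> R \<longleftrightarrow> m z \<notin> R) \<and> (z \<in> R \<longleftrightarrow> n' z \<notin> R)"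
        using psubset.IH[OF V' mV' nV'] ..
      note R = this[rule_format]
      have out: "m z \<in> V'" if "z \<in> V'" for z
        using mV' that by (auto simp: involution_on_def)
      \<comment> \<open>The colour of \<open>x\<close> must differ from that of \<open>x'\<close>,
        and the colour of \<open>y\<close> from that of \<open>y'\<close>. As \<open>n'\<close>
        matches \<open>x'\<close> with \<open>y'\<close>, these two have different colours, hence so
        do \<open>x\<close> and \<open>y\<close>, as \<open>m\<close> demands.\<close>
      define c where "c = (if x' \<in> R then y else x)"
      define S where "S = insert c (R - {x, y})"
      have S: "z \<in> S \<longleftrightarrow> z \<in> R" if "z \<in> V'" for z
        using that by (auto simp: S_def V'_def c_def)
      have Sxy: "x \<in> S \<longleftrightarrow> x' \<notin> R" "y \<in> S \<longleftrightarrow> x' \<in> R"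
        using y by (auto simp: S_def c_def)
      have xyR: "x' \<in> R \<longleftrightarrow> y' \<notin> R"
        using R[OF x'(1)] ne by (auto simp: n'_def)
      show ?thesis
      proof (intro exI[of _ S] ballI)
        fix z assume "z \<in> V"
        then consider "z = x" | "z = y" | "z = x'" | "z = y'" | "z \<in> V' - {x', y'}"
          by (auto simp: V'_def)
        then show "(z \<in> S \<longleftrightarrow> m z \<notin> S) \<and> (z \<in> S \<longleftrightarrow> n z \<notin> S)"
        proof cases
          case 1
          then show ?thesis using Sxy S[OF x'(1)] by (simp add: y_def[symmetric] x'_def[symmetric])
        next
          case 2
          then show ?thesis using Sxy S[OF y'(1)] xyR y(3) by (simp add: y'_def[symmetric])
        next
          case 3
          then show ?thesis using Sxy S[OF x'(1)] S[OF out[OF x'(1)]] R[OF x'(1)] x'(2) by simp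
        next
          case 4
          then show ?thesis using Sxy S[OF y'(1)] S[OF out[OF y'(1)]] R[OF y'(1)] y'(2) xyR by simp
        next
          case 5
          then have "z \<in> V'" "n z \<in> V'" "n' z = n z" using nV[OF 5] by (auto simp: n'_def)
          then show ?thesis using R[of z] S[of z] S[of "n z"] S[OF out[of z]] by auto
        qed
      qed
    qed
  qed auto
qed

text \<open>A colour class \<open>R\<close> of the bipartite graph \<open>M \<union> N\<close>
  contains exactly one end of every edge of either matching. Sending an edge of \<open>M\<close> to
  the edge of \<open>N\<close> at its end in \<open>R\<close> is therefore a bijection between
  adjacent edges.\<close>

lemma perfect_matchings_adjacent_bij:
  assumes "finite V" "perfect_matching V M" "perfect_matching V N"
  shows "\<exists>f. bij_betw f M N \<and> (\<forall>e\<in>M. e \<inter> f e \<noteq> {})"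
proof -
  obtain m where m: "involution_on V m" "M = (\<lambda>x. {x, m x}) ` V"
    using assms(2) by (auto simp: perfect_matching_def)
  obtain n where n: "involution_on V n" "N = (\<lambda>x. {x, n x}) ` V"
    using assms(3) by (auto simp: perfect_matching_def)
  obtain R where R: "\<And>x. x \<in> V \<Longrightarrow> (x \<in> R \<longleftrightarrow> m x \<notin> R) \<and> (x \<in> R \<longleftrightarrow> n x \<notin> R)"
    using two_involutions_colouring[OF assms(1) m(1) n(1)] by blast
  have "\<exists>x. x \<in> e \<inter> R" if "e \<in> M" for e
    using that R m by (auto simp: involution_on_def)
  then obtain g where g: "\<And>e. e \<in> M \<Longrightarrow> g e \<in> e \<inter> R" by metis
  have gV: "g e \<in> V" if "e \<in> M" for e
    using g[OF that] perfect_matching_edge(2)[OF assms(2) that] by blast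
  define f where "f e = {g e, n (g e)}" for e
  have "inj_on f M"
  proof (rule inj_onI)
    fix e e' assume e: "e \<in> M" "e' \<in> M" "f e = f e'"
    have "n (g e) \<notin> R" "n (g e') \<notin> R" using R[OF gV[OF e(1)]] R[OF gV[OF e(2)]] g e by auto
    then have "g e = g e'" using e g[OF e(1)] g[OF e(2)] by (auto simp: f_def doubleton_eq_iff)
    then have "e \<inter> e' \<noteq> {}" using g[OF e(1)] g[OF e(2)] by auto
    then show "e = e'" using perfect_matching_disjoint[OF assms(2) e(1,2)] by blast
  qed
  moreover have "f ` M \<subseteq> N" using gV n(2) by (auto simp: f_def)
  moreover have "card M = card N"
    using perfect_matching_card[OF assms(1,2)] perfect_matching_card[OF assms(1,3)] by simp
  ultimately have "bij_betw f M N"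
    using perfect_matching_finite[OF assms(1,3)] card_subset_eq[of N "f ` M"]
    by (simp add: bij_betw_def card_image)
  moreover have "e \<inter> f e \<noteq> {}" if "e \<in> M" for e
    using g[OF that] by (auto simp: f_def)
  ultimately show ?thesis by blast
qed

section \<open>Packing perfect matchings, alone and with stars\<close>

lemma pack_two_matchings:
  assumes "finite V" "perfect_matching V F" "perfect_matching V G" "F \<inter> G = {}"
  shows "pack V (F \<union> G) (card F)"
proof -
  obtain f where f: "bij_betw f F G" "\<forall>e\<in>F. e \<inter> f e \<noteq> {}"
    using perfect_matchings_adjacent_bij[OF assms(1-3)] by blast
  have fe: "f e \<in> G" if "e \<in> F" for e using f(1) that by (auto simp: bij_betw_def)
  have "pack V (id ` F \<union> f ` F) (card F)"
    using f assms(4) fe perfect_matching_edge[OF assms(2)] perfect_matching_edge[OF assms(3)]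
    by (intro pack_path3_family perfect_matching_finite[OF assms(1,2)]) (auto simp: bij_betw_def)
  then show ?thesis using f(1) by (simp add: bij_betw_def)
qed

lemma pack_star_two_matchings:
  assumes "finite V" "perfect_matching V F" "perfect_matching V G" "F \<inter> G = {}" "z \<notin> V"
  shows "pack V (star z V \<union> F \<union> G) 0"
proof -
  obtain f where f: "bij_betw f F G" "\<forall>e\<in>F. e \<inter> f e \<noteq> {}"
    using perfect_matchings_adjacent_bij[OF assms(1-3)] by blast
  have fe: "f e \<in> G" if "e \<in> F" for e using f(1) that by (auto simp: bij_betw_def)
  have "pack V (star z (\<Union>(id ` F)) \<union> id ` F \<union> f ` F) 0"
  proof (rule pack_paw_family[OF perfect_matching_finite[OF assms(1,2)]])
    show "card (id e) = 2 \<and> card (f e) = 2 \<and> id e \<inter> f e \<noteq> {} \<and> id e \<subseteq> V \<and> f e \<subseteq> V" if "e \<in> F" for e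
      using that f fe perfect_matching_edge[OF assms(2)] perfect_matching_edge[OF assms(3)] by simp
    show "id e \<inter> id e' = {}" if "e \<in> F" "e' \<in> F" "e \<noteq> e'" for e e'
      using perfect_matching_disjoint[OF assms(2)] that by simp
  qed (use f assms in \<open>auto simp: bij_betw_def\<close>)
  then show ?thesis using f(1) perfect_matching_Union[OF assms(2)] by (simp add: bij_betw_def)
qed

text \<open>The triangles over \<open>F\<close> have three edges, so each has room for one more edge
  at \<open>z\<close>. The set \<open>U\<close> stands for other vertices of \<open>W\<close>: some
  edges inside \<open>W\<close> are disposed of in this way.\<close>

lemma pack_star_matching:
  assumes "finite V" "perfect_matching V F" "z \<notin> V" "finite U" "U \<inter> V = {}" "z \<notin> U" "card U \<le> card F"
  shows "pack V (star z V \<union> F \<union> star z U) 0"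
proof -
  obtain j where j: "inj_on j U" "j ` U \<subseteq> F"
    using card_le_inj[OF assms(4) perfect_matching_finite[OF assms(1,2)] assms(7)] by blast
  define Q where "Q e = {u \<in> U. j u = e}" for e
  have "pack V (\<Union>e\<in>F. star z e \<union> {e} \<union> star z (Q e)) (\<Sum>e\<in>F. 0)"
  proof (rule pack_UN[OF perfect_matching_finite[OF assms(1,2)]])
    fix e assume e: "e \<in> F"
    have ze: "z \<notin> e" using perfect_matching_edge(2)[OF assms(2) e] assms(3) by blast
    show "pack V (star z e \<union> {e} \<union> star z (Q e)) 0"
    proof (cases "Q e = {}")
      case True
      then show ?thesis using pack_triangle[OF perfect_matching_edge(1)[OF assms(2) e] ze assms(3)] by simp
    next
      case False
      then obtain u where u: "u \<in> U" "j u = e" by (auto simp: Q_def)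
      then have Q: "Q e = {u}" using j(1) by (auto simp: Q_def inj_on_def)
      have "u \<notin> e" "u \<noteq> z" using u perfect_matching_edge(2)[OF assms(2) e] assms(5,6) by auto
      from pack_triangle_pendant[OF perfect_matching_edge(1)[OF assms(2) e] ze assms(3) this]
      show ?thesis unfolding Q by (simp add: insert_commute)
    qed
  next
    fix e e' assume e: "e \<in> F" "e' \<in> F" "e \<noteq> e'"
    have ze: "z \<notin> e" "z \<notin> e'" "e \<subseteq> V" "e' \<subseteq> V"
      using perfect_matching_edge(2)[OF assms(2) e(1)] perfect_matching_edge(2)[OF assms(2) e(2)] assms(3) by auto
    have "star z (e \<union> Q e) \<inter> star z (e' \<union> Q e') = {}"
      using ze assms(5,6) perfect_matching_disjoint[OF assms(2) e] e(3)
      by (intro star_disjoint) (auto simp: Q_def)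
    moreover have "{e} \<inter> star z S = {}" "{e'} \<inter> star z S = {}" for S using ze by (auto simp: star_def)
    ultimately show "(star z e \<union> {e} \<union> star z (Q e)) \<inter> (star z e' \<union> {e'} \<union> star z (Q e')) = {}"
      using e(3) unfolding star_Un by blast
  qed
  moreover have "(\<Union>e\<in>F. star z e \<union> {e} \<union> star z (Q e)) = star z V \<union> F \<union> star z U"
  proof -
    have "(\<Union>e\<in>F. star z e) = star z V"
      using star_UN[of z id F] perfect_matching_Union[OF assms(2)] by simp
    moreover have "(\<Union>e\<in>F. star z (Q e)) = star z U"
    proof -
      have "(\<Union>e\<in>F. Q e) = U" using j(2) by (auto simp: Q_def)
      then show ?thesis using star_UN[of z Q F] by simp
    qed
    moreover have "(\<Union>e\<in>F. star z e \<union> {e} \<union> star z (Q e)) =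
        (\<Union>e\<in>F. star z e) \<union> F \<union> (\<Union>e\<in>F. star z (Q e))" by blast
    ultimately show ?thesis by simp
  qed
  ultimately show ?thesis by simp
qed

text \<open>Any perfect matching serves to group the vertices of \<open>V\<close> in pairs for the
  4-cycles; its edges stay available for other blocks.\<close>

lemma pack_two_stars:
  assumes "finite V" "even (card V)" "z \<notin> V" "z' \<notin> V" "z \<noteq> z'"
  shows "pack V (star z V \<union> star z' V) 0"
proof -
  obtain F where F: "perfect_matching V F" using exists_perfect_matching[OF assms(1,2)] by blast
  have "pack V (\<Union>e\<in>F. star z e \<union> star z' e) (\<Sum>e\<in>F. 0)"
  proof (rule pack_UN[OF perfect_matching_finite[OF assms(1) F]])
    fix e assume "e \<in> F"
    note e = perfect_matching_edge[OF F this]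
    show "pack V (star z e \<union> star z' e) 0" using e assms by (intro pack_4_cycle) auto
  next
    fix e e' assume e: "e \<in> F" "e' \<in> F" "e \<noteq> e'"
    have "e \<subseteq> V" "e' \<subseteq> V" "e \<inter> e' = {}"
      using perfect_matching_edge(2)[OF F] perfect_matching_disjoint[OF F e] e by auto
    then show "(star z e \<union> star z' e) \<inter> (star z e' \<union> star z' e') = {}"
      using assms(3-5) by (auto simp: star_def doubleton_eq_iff)
  qed
  moreover have "(\<Union>e\<in>F. star z e \<union> star z' e) = star z V \<union> star z' V"
    using star_UN[of z id F] star_UN[of z' id F] perfect_matching_Union[OF F] by (simp add: UN_Un_distrib)
  ultimately show ?thesis by simp
qed

section \<open>A one-factorization of the complete graph\<close>

text \<open>
  \<open>lab\<close> labels the vertices other than \<open>apex\<close> by the integers modulo \<open>2k - 1\<close>; the factor of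
  colour \<open>s\<close> consists of the pairs with label sum \<open>s\<close>, where \<open>apex\<close> copies the label of its partner.
\<close>

definition cyclic_labelling :: "nat \<Rightarrow> 'a set \<Rightarrow> (int \<Rightarrow> 'a) \<Rightarrow> 'a \<Rightarrow> bool" where
  "cyclic_labelling k V lab apex \<longleftrightarrow> V = insert apex (range lab) \<and> apex \<notin> range lab \<and>
     (\<forall>i j. lab i = lab j \<longleftrightarrow> (2 * int k - 1) dvd i - j)"

definition factor :: "nat \<Rightarrow> (int \<Rightarrow> 'a) \<Rightarrow> 'a \<Rightarrow> int \<Rightarrow> 'a set set" where
  "factor k lab apex s =
     {{lab i, lab j} | i j. lab i \<noteq> lab j \<and> (2 * int k - 1) dvd i + j - s} \<union>
     {{apex, lab i} | i. (2 * int k - 1) dvd 2 * i - s}"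

lemma exists_cyclic_labelling:
  assumes "card V = 2 * k" "k \<ge> 1"
  shows "\<exists>lab apex. cyclic_labelling k V lab apex"
proof -
  define m where "m = 2 * k - 1"
  have m: "card V = Suc m" "int m = 2 * int k - 1" "m > 0" using assms by (auto simp: m_def)
  have "finite V" using m(1) by (intro card_ge_0_finite) simp
  then obtain h where h: "bij_betw h {0..<Suc m} V"
    using ex_bij_betw_nat_finite m(1) by metis
  define lab where "lab i = h (nat (i mod int m))" for i
  have r: "nat (i mod int m) < m" for i
    using m(3) by (simp add: nat_less_iff)
  have hinj: "h i = h j \<longleftrightarrow> i = j" if "i < Suc m" "j < Suc m" for i j
    using h that by (auto simp: bij_betw_def inj_on_def)
  have "V = h ` {0..<Suc m}" using h by (simp add: bij_betw_def)
  also have "\<dots> = insert (h m) (h ` {0..<m})" by (simp add: atLeast0_lessThan_Suc)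
  also have "h ` {0..<m} = range lab"
  proof
    show "h ` {0..<m} \<subseteq> range lab"
    proof
      fix x assume "x \<in> h ` {0..<m}"
      then obtain i where "i < m" "x = h i" by auto
      then have "x = lab (int i)" by (simp add: lab_def)
      then show "x \<in> range lab" by blast
    qed
    show "range lab \<subseteq> h ` {0..<m}" using r by (auto simp: lab_def)
  qed
  finally have "V = insert (h m) (range lab)" .
  moreover have "h m \<notin> range lab"
  proof
    assume "h m \<in> range lab"
    then obtain i where "h m = h (nat (i mod int m))" by (auto simp: lab_def)
    then show False using hinj[of m "nat (i mod int m)"] r[of i] by simp
  qed
  moreover have "lab i = lab j \<longleftrightarrow> (2 * int k - 1) dvd i - j" for i j
  proof -
    have "lab i = lab j \<longleftrightarrow> nat (i mod int m) = nat (j mod int m)"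
      unfolding lab_def using hinj r by (meson less_SucI)
    also have "\<dots> \<longleftrightarrow> i mod int m = j mod int m"
      using m(3) by (intro eq_nat_nat_iff) auto
    also have "\<dots> \<longleftrightarrow> int m dvd i - j" by (simp add: mod_eq_dvd_iff)
    finally show ?thesis by (simp add: m(2))
  qed
  ultimately show ?thesis unfolding cyclic_labelling_def by blast
qed

context
  fixes k :: nat and V :: "'a set" and lab :: "int \<Rightarrow> 'a" and apex :: 'a
  assumes k: "k \<ge> 1" and lab: "cyclic_labelling k V lab apex"
begin

private abbreviation (input) m :: int where "m \<equiv> 2 * int k - 1"
private abbreviation (input) fac where "fac \<equiv> factor k lab apex"

lemma lab_eq: "lab i = lab j \<longleftrightarrow> m dvd i - j"
  and lab_V: "V = insert apex (range lab)" and apex_lab: "apex \<noteq> lab i"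
  using lab unfolding cyclic_labelling_def by auto

lemma m_dvd_double: "m dvd 2 * i \<longleftrightarrow> m dvd i"
proof -
  have "coprime m (2::int)" by simp
  then show ?thesis using coprime_dvd_mult_right_iff by blast
qed

lemma lab_pair_in_factor: "{lab i, lab j} \<in> fac s \<longleftrightarrow> lab i \<noteq> lab j \<and> m dvd i + j - s"
proof
  assume "{lab i, lab j} \<in> fac s"
  then obtain i' j' where ij: "{lab i, lab j} = {lab i', lab j'}" "lab i' \<noteq> lab j'" "m dvd i' + j' - s"
    using apex_lab by (auto simp: factor_def doubleton_eq_iff)
  then have "m dvd (i - i') + (j - j') \<or> m dvd (i - j') + (j - i')"
    by (auto simp: doubleton_eq_iff lab_eq intro: dvd_add)
  then have "m dvd (i + j) - (i' + j')" by (auto simp: algebra_simps)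
  from dvd_add[OF this ij(3)] have "m dvd i + j - s" by (simp add: algebra_simps)
  moreover have "lab i \<noteq> lab j" using ij(1,2) by (auto simp: doubleton_eq_iff)
  ultimately show "lab i \<noteq> lab j \<and> m dvd i + j - s" by simp
qed (auto simp: factor_def)

lemma apex_pair_in_factor: "{apex, lab i} \<in> fac s \<longleftrightarrow> m dvd 2 * i - s"
proof
  assume "{apex, lab i} \<in> fac s"
  then obtain i' where i': "lab i = lab i'" "m dvd 2 * i' - s"
    using apex_lab by (auto simp: factor_def doubleton_eq_iff)
  then have "m dvd 2 * (i - i')" by (simp only: lab_eq dvd_mult)
  from dvd_add[OF this i'(2)] show "m dvd 2 * i - s" by (simp add: algebra_simps)
qed (auto simp: factor_def)

text \<open>The partner of label \<open>i\<close> has label \<open>s - i\<close>. Since the modulus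
  is odd, this reflection fixes exactly one label, the half of \<open>s\<close>, and that vertex is
  matched with \<open>apex\<close>.\<close>

lemma perfect_matching_factor: "perfect_matching V (fac s)"
proof -
  define ix where "ix x = (SOME i. lab i = x)" for x
  define n where "n x = (if x = apex then lab (s * int k) else
      if m dvd 2 * ix x - s then apex else lab (s - ix x))" for x
  have ix: "m dvd ix (lab i) - i" for i
    unfolding lab_eq[symmetric] ix_def by (rule someI[of _ i]) simp
  have ix2: "m dvd 2 * ix (lab i) - s \<longleftrightarrow> m dvd 2 * i - s" for i
  proof -
    have "(2 * ix (lab i) - s) - (2 * i - s) = 2 * (ix (lab i) - i)" by simp
    then have "m dvd (2 * ix (lab i) - s) - (2 * i - s)" using dvd_mult[OF ix[of i], of 2] by argo
    then show ?thesis by (metis dvd_diff_left_iff dvd_diff_right_iff)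
  qed
  have n_lab: "n (lab i) = (if m dvd 2 * i - s then apex else lab (s - i))" for i
    using ix[of i] apex_lab[of i] unfolding n_def ix2 
    by (auto simp: lab_eq dvd_diff_commute)
  \<comment> \<open>Modulo \<open>2k - 1\<close> the inverse of \<open>2\<close> is
    \<open>k\<close>, so \<open>s * k\<close> is the half of \<open>s\<close>.\<close>
  have half: "m dvd 2 * (s * int k) - s"
    by (rule dvdI[of _ _ s]) (simp add: algebra_simps)
  have n_apex: "n apex = lab (s * int k)" by (simp add: n_def)
  have eq_half: "lab (s * int k) = lab i" if "m dvd 2 * i - s" for i
  proof -
    have "m dvd 2 * (s * int k - i)" using dvd_diff[OF half that] by (simp add: right_diff_distrib)
    then show ?thesis by (simp only: lab_eq m_dvd_double)
  qed
  have neq: "lab i \<noteq> lab (s - i)" if "\<not> m dvd 2 * i - s" for i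
    using that by (simp add: lab_eq)
  have refl: "m dvd 2 * (s - i) - s \<longleftrightarrow> m dvd 2 * i - s" for i
    using dvd_minus_iff[of m "2 * i - s"] by (simp add: algebra_simps)
  have "involution_on V n"
    unfolding involution_on_def
  proof
    fix x assume "x \<in> V"
    then consider "x = apex" | i where "x = lab i" using lab_V by blast
    then show "n x \<in> V \<and> n x \<noteq> x \<and> n (n x) = x"
    proof cases
      case 1
      then show ?thesis using half n_apex n_lab[of "s * int k"] apex_lab[THEN not_sym] lab_V by simp
    next
      case (2 i)
      show ?thesis
      proof (cases "m dvd 2 * i - s")
        case True
        then show ?thesis using 2 n_lab[of i] n_apex eq_half[OF True] apex_lab[of i] lab_V by simp
      next
        case False
        then have "n x = lab (s - i)" using 2 n_lab[of i] by simp
        moreover have "n (lab (s - i)) = lab i" using False n_lab[of "s - i"] refl[of i] by simp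
        ultimately show ?thesis using 2 neq[OF False] lab_V by auto
      qed
    qed
  qed
  moreover have "fac s = (\<lambda>x. {x, n x}) ` V"
  proof
    show "fac s \<subseteq> (\<lambda>x. {x, n x}) ` V"
    proof
      fix e assume "e \<in> fac s"
      then consider i j where "e = {lab i, lab j}" "lab i \<noteq> lab j" "m dvd i + j - s"
        | i where "e = {apex, lab i}" "m dvd 2 * i - s"
        unfolding factor_def by blast
      then show "e \<in> (\<lambda>x. {x, n x}) ` V"
      proof cases
        case (1 i j)
        have "lab j = lab (s - i)" using 1(3) by (simp add: lab_eq algebra_simps)
        moreover have "\<not> m dvd 2 * i - s"
        proof
          assume "m dvd 2 * i - s"
          from dvd_diff[OF this 1(3)] show False using 1(2) by (simp add: lab_eq algebra_simps)
        qed
        ultimately have "e = {lab i, n (lab i)}" using 1(1) n_lab by simp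
        then show ?thesis using lab_V by blast
      next
        case (2 i)
        then have "e = {apex, n apex}" using n_apex eq_half by simp
        then show ?thesis using lab_V by blast
      qed
    qed
    show "(\<lambda>x. {x, n x}) ` V \<subseteq> fac s"
    proof
      fix e assume "e \<in> (\<lambda>x. {x, n x}) ` V"
      then consider "e = {apex, n apex}" | i where "e = {lab i, n (lab i)}"
        using lab_V by blast
      then show "e \<in> fac s"
      proof cases
        case 1
        then show ?thesis using half n_apex apex_pair_in_factor by simp
      next
        case (2 i)
        show ?thesis
        proof (cases "m dvd 2 * i - s")
          case True
          then show ?thesis using 2 n_lab[of i] apex_pair_in_factor[of i s] by (simp add: insert_commute)
        next
          case False
          then show ?thesis using 2 n_lab[of i] lab_pair_in_factor[of i "s - i" s] neq[OF False] by simp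
        qed
      qed
    qed
  qed
  ultimately show ?thesis unfolding perfect_matching_def by blast
qed

text \<open>The sum of the two labels, or twice the label of the partner of \<open>apex\<close>,
  fixes the colour of an edge modulo \<open>m\<close>.\<close>

lemma factor_disjoint:
  assumes "e \<in> fac s" "e \<in> fac t"
  shows "m dvd s - t"
proof -
  have "e \<in> fac s \<Longrightarrow> \<exists>c. \<forall>t. e \<in> fac t \<longrightarrow> m dvd c - t"
  proof -
    assume "e \<in> fac s"
    then consider i j where "e = {lab i, lab j}" | i where "e = {apex, lab i}"
      unfolding factor_def by blast
    then show ?thesis
    proof cases
      case (1 i j)
      then show ?thesis using lab_pair_in_factor by blast
    next
      case (2 i)
      then show ?thesis using apex_pair_in_factor by blast
    qed
  qed
  then obtain c where c: "\<And>t. e \<in> fac t \<Longrightarrow> m dvd c - t" using assms by blast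
  from dvd_diff[OF c[OF assms(2)] c[OF assms(1)]] show ?thesis by simp
qed

lemma factor_inj: "inj_on fac {0..<m}"
proof (rule inj_onI)
  fix s t assume st: "s \<in> {0..<m}" "t \<in> {0..<m}" "fac s = fac t"
  have "{apex, lab (s * int k)} \<in> fac s"
    unfolding apex_pair_in_factor by (rule dvdI[of _ _ s]) (simp add: algebra_simps)
  then have "m dvd s - t" using factor_disjoint[of _ s t] st(3) by simp
  then have "s mod m = t mod m" by (simp add: mod_eq_dvd_iff)
  then show "s = t" using st by simp
qed

lemma factor_disjoint_sets:
  assumes "s \<in> {0..<m}" "t \<in> {0..<m}" "s \<noteq> t"
  shows "fac s \<inter> fac t = {}"
proof (rule ccontr)
  assume "fac s \<inter> fac t \<noteq> {}"
  then have "m dvd s - t" using factor_disjoint by blast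
  then have "s mod m = t mod m" by (simp add: mod_eq_dvd_iff)
  then show False using assms by simp
qed

lemma factor_Union: "(\<Union>s\<in>{0..<m}. fac s) = nsets V 2"
proof
  show "(\<Union>s\<in>{0..<m}. fac s) \<subseteq> nsets V 2"
  proof
    fix e assume "e \<in> (\<Union>s\<in>{0..<m}. fac s)"
    then obtain s where "e \<in> fac s" by blast
    from perfect_matching_edge[OF perfect_matching_factor this] show "e \<in> nsets V 2"
      by (simp add: nsets_def card_ge_0_finite)
  qed
  show "nsets V 2 \<subseteq> (\<Union>s\<in>{0..<m}. fac s)"
  proof
    fix e assume "e \<in> nsets V 2"
    then obtain x y where xy: "e = {x, y}" "x \<in> V" "y \<in> V" "x \<noteq> y" by (auto simp: nsets_2_eq)
    have mpos: "m > 0" using k by simp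
    have md: "m dvd c - c mod m" for c by (simp add: dvd_minus_mod)
    have "c mod m \<in> {0..<m}" for c using mpos by simp
    moreover consider i j where "x = lab i" "y = lab j" | i where "x = apex" "y = lab i"
      | i where "x = lab i" "y = apex"
      using xy lab_V by blast
    then have "\<exists>c. e \<in> fac (c mod m)"
    proof cases
      case (1 i j)
      then have "e \<in> fac ((i + j) mod m)" using lab_pair_in_factor xy(1,4) md by blast
      then show ?thesis by blast
    next
      case (2 i)
      then have "e \<in> fac ((2 * i) mod m)" using apex_pair_in_factor xy(1) md by blast
      then show ?thesis by blast
    next
      case (3 i)
      then have "e \<in> fac ((2 * i) mod m)" using apex_pair_in_factor xy(1) md by (metis insert_commute)
      then show ?thesis by blast
    qed
    ultimately show "e \<in> (\<Union>s\<in>{0..<m}. fac s)" by blast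
  qed
qed

text \<open>
  The factors of colours \<open>2\<close> and \<open>-2\<close> form the Hamiltonian cycle \<open>apex, 1, -3, 5, -7, \<dots>\<close>, on which
  colour \<open>0\<close> acts as the reflection negating the labels.
\<close>

definition zigzag :: "nat \<Rightarrow> int" where
  "zigzag j = (-1) ^ (j + 1) * (2 * int j - 1)"

lemma zigzag_parity: "zigzag j = (if even j then 1 - 2 * int j else 2 * int j - 1)"
  by (simp add: zigzag_def)

definition ham :: "nat \<Rightarrow> 'a" where
  "ham j = (if j mod (2 * k) = 0 then apex else lab (zigzag (j mod (2 * k))))"

lemma ham_0: "ham 0 = apex" and ham_lab: "0 < j \<Longrightarrow> j < 2 * k \<Longrightarrow> ham j = lab (zigzag j)"
  and ham_period: "ham (j + 2 * k) = ham j"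
  by (simp_all add: ham_def)

lemma ham_in_V: "ham j \<in> V"
  using lab_V by (simp add: ham_def)

text \<open>For indices of equal parity the difference is \<open>2 * (i - j)\<close> up to sign, too
  small to be a nonzero multiple of the odd \<open>m\<close> after halving. For opposite parity it
  is \<open>2 * (i + j - 1)\<close> up to sign; the only multiple of \<open>m\<close> in range is
  \<open>i + j - 1 = m\<close>, and then \<open>i + j = 2 * k\<close> contradicts the
  parities.\<close>

lemma lab_zigzag_inj:
  assumes "0 < i" "i < 2 * k" "0 < j" "j < 2 * k" "lab (zigzag i) = lab (zigzag j)"
  shows "i = j"
proof -
  have d: "m dvd zigzag i - zigzag j" using assms(5) by (simp add: lab_eq)
  show ?thesis
  proof (cases "even i = even j")
    case True
    then have "zigzag i - zigzag j = 2 * (int i - int j) \<or> zigzag i - zigzag j = - (2 * (int i - int j))"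
      by (auto simp: zigzag_parity)
    then have "m dvd 2 * (int i - int j)" using d by (metis dvd_minus_iff)
    then have "m dvd int i - int j" by (simp only: m_dvd_double)
    show ?thesis
    proof (rule ccontr)
      assume "i \<noteq> j"
      then have "m \<le> \<bar>int i - int j\<bar>" using \<open>m dvd int i - int j\<close> by (intro zdvd_imp_le) auto
      then show False using assms(1-4) by linarith
    qed
  next
    case False
    then have "zigzag i - zigzag j = 2 * (int i + int j - 1) \<or> zigzag i - zigzag j = - (2 * (int i + int j - 1))"
      by (auto simp: zigzag_parity)
    then have "m dvd 2 * (int i + int j - 1)" using d by (metis dvd_minus_iff)
    then have "m dvd int i + int j - 1" by (simp only: m_dvd_double)
    then obtain c where c: "int i + int j - 1 = m * c" by (elim dvdE)
    have le: "int i \<le> m" "int j \<le> m" "0 < int i" "0 < int j" using assms(1-4) by simp_all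
    have "0 < int i + int j - 1" using le(3,4) by simp
    moreover have "int i + int j - 1 < 2 * m" using add_mono[OF le(1,2)] by simp
    ultimately
    have "0 < m * c" "m * c < m * 2" unfolding c by simp_all
    moreover have "0 < m" using k by simp
    ultimately have "0 < c" "c < 2"
      by (simp_all only: zero_less_mult_iff mult_less_cancel_left_pos) simp
    then have "c = 1" by simp
    then have "i + j = 2 * k" using c by simp
    then have "even (i + j)" by simp
    then show ?thesis using False by simp
  qed
qed

lemma ham_inj: "inj_on ham {..<2 * k}"
proof (rule inj_onI)
  fix i j assume ij: "i \<in> {..<2 * k}" "j \<in> {..<2 * k}" "ham i = ham j"
  show "i = j"
  proof (cases "i = 0 \<or> j = 0")
    case True
    then show ?thesis using ij ham_0 ham_lab[of i] ham_lab[of j] apex_lab by fastforce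
  next
    case False
    then show ?thesis using ij lab_zigzag_inj[of i j] ham_lab[of i] ham_lab[of j] by simp
  qed
qed

lemma ham_image:
  assumes "finite V" "card V = 2 * k"
  shows "ham ` {..<2 * k} = V"
  using assms ham_in_V by (intro card_subset_eq) (auto simp: card_image[OF ham_inj])

text \<open>Consecutive labels of the zigzag sum to \<open>2\<close> and \<open>-2\<close>
  alternately; \<open>m - 2\<close> represents \<open>-2\<close> in the range of colours. The edges
  at \<open>apex\<close> fit in with labels \<open>1\<close> and \<open>4k - 3\<close>.\<close>

lemma ham_edge:
  assumes "j < 2 * k" 
  shows "{ham j, ham (j + 1)} \<in> fac (if even j then 2 else m - 2)"
proof -
  consider "j = 0" | "j = 2 * k - 1" | "0 < j" "j + 1 < 2 * k" using assms by linarith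
  then show ?thesis
  proof cases
    case 1
    have "ham 1 = lab 1" using k by (simp add: ham_lab zigzag_parity)
    then show ?thesis using 1 ham_0 apex_pair_in_factor[of 1 2] by simp
  next
    case 2
    have "ham j = lab (2 * int j - 1)" using 2 k by (simp add: ham_lab zigzag_parity)
    moreover have "ham (j + 1) = apex" using 2 k by (simp add: ham_def)
    \<comment> \<open>For \<open>j = 2 * k - 1\<close> the value is \<open>6 * k - 3\<close>, three
      times \<open>m\<close>.\<close>
    moreover have "m dvd 2 * (2 * int j - 1) - (m - 2)"
      using 2 k by (intro dvdI[of _ _ 3]) (simp add: of_nat_diff algebra_simps)
    moreover have "odd j" using 2 k by simp
    ultimately show ?thesis using apex_pair_in_factor by (simp add: insert_commute)
  next
    case 3
    have h: "ham j = lab (zigzag j)" "ham (j + 1) = lab (zigzag (j + 1))" using 3 by (auto intro: ham_lab)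
    have "lab (zigzag j) \<noteq> lab (zigzag (j + 1))" using lab_zigzag_inj[of j "j + 1"] 3 by auto
    moreover have "m dvd zigzag j + zigzag (j + 1) - (if even j then 2 else m - 2)"
      using dvd_minus_iff[of m m] by (simp add: zigzag_parity)
    ultimately show ?thesis unfolding h lab_pair_in_factor by simp
  qed
qed

definition chord :: "nat \<Rightarrow> 'a set" where
  "chord j = {ham j, ham (if j = 0 then k else 2 * k - j)}"

text \<open>Up to sign, \<open>zigzag k\<close> is \<open>m\<close> itself, so the vertex opposite
  to \<open>apex\<close> has label zero modulo \<open>m\<close>; for positive \<open>j\<close> the
  labels at \<open>j\<close> and \<open>2 * k - j\<close> sum to \<open>2 * m\<close> up to
  sign.\<close>

lemma chord_in_factor:
  assumes "j < k"
  shows "chord j \<in> fac 0"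
proof (cases "j = 0")
  case True
  have "m dvd 2 * zigzag k" by (simp add: m_dvd_double zigzag_def)
  moreover have "ham k = lab (zigzag k)" using k by (simp add: ham_lab)
  ultimately show ?thesis using True ham_0 apex_pair_in_factor[of "zigzag k" 0] by (simp add: chord_def)
next
  case False
  have h: "ham j = lab (zigzag j)" "ham (2 * k - j) = lab (zigzag (2 * k - j))"
    using False assms by (auto intro: ham_lab)
  have "lab (zigzag j) \<noteq> lab (zigzag (2 * k - j))"
    using lab_zigzag_inj[of j "2 * k - j"] False assms by auto
  moreover have "even (2 * k - j) = even j" using assms by simp
  then have "zigzag j + zigzag (2 * k - j) = (if even j then - 2 else 2) * m"
    using assms by (simp add: zigzag_parity of_nat_diff)
  then have "m dvd zigzag j + zigzag (2 * k - j)" by (metis dvd_triv_right)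
  ultimately show ?thesis using False h by (simp add: chord_def lab_pair_in_factor)
qed

end

text \<open>
  \<open>D\<close> is a Hamiltonian cycle \<open>u 0, u 1, \<dots>\<close>, and the rungs \<open>A\<close> are the chords preserved by its
  reflection \<open>j \<mapsto> 2k - j\<close>, together with the chord joining the two fixed points \<open>0\<close> and \<open>k\<close>.
\<close>

definition ladder :: "nat \<Rightarrow> 'a set \<Rightarrow> (nat \<Rightarrow> 'a) \<Rightarrow> 'a set set \<Rightarrow> 'a set set \<Rightarrow> bool" where
  "ladder k V u A D \<longleftrightarrow> inj_on u {..<2 * k} \<and> u ` {..<2 * k} = V \<and> (\<forall>j. u (j + 2 * k) = u j) \<and>
     D = (\<lambda>j. {u j, u (j + 1)}) ` {..<2 * k} \<and>
     A = (\<lambda>j. {u j, u (if j = 0 then k else 2 * k - j)}) ` {..<k}"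

lemma one_factorization_with_ladder:
  assumes "finite V" "card V = 2 * k" "k \<ge> 2"
  obtains \<F> A B C u where "matchings V \<F>" "card \<F> = 2 * k - 1" "\<Union>\<F> = nsets V 2"
    "{A, B, C} \<subseteq> \<F>" "A \<noteq> B" "A \<noteq> C" "B \<noteq> C" "ladder k V u A (B \<union> C)"
proof -
  have k: "k \<ge> 1" using assms(3) by simp
  obtain lab apex where lab: "cyclic_labelling k V lab apex"
    using exists_cyclic_labelling[OF assms(2) k] by blast
  define m where "m = 2 * int k - 1"
  define fac where "fac = factor k lab apex"
  define u where "u = ham k lab apex"
  have m: "m \<ge> 3" using assms(3) by (simp add: m_def)
  note pm = perfect_matching_factor[OF k lab, folded fac_def]
  have img: "u ` {..<2 * k} = V" unfolding u_def by (rule ham_image[OF k lab assms(1,2)])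
  have period: "u (j + 2 * k) = u j" for j unfolding u_def by (rule ham_period[OF k lab])
  have edge: "{u j, u (j + 1)} \<in> fac (if even j then 2 else m - 2)" if "j < 2 * k" for j
    unfolding u_def fac_def m_def by (rule ham_edge[OF k lab that])
  define ch where "ch j = {u j, u (if j = 0 then k else 2 * k - j)}" for j
  have chord: "ch j \<in> fac 0" if "j < k" for j
    using chord_in_factor[OF k lab that] unfolding ch_def u_def fac_def chord_def[OF k lab] .
  have uniq: "e = e'" if "e \<in> fac s" "e' \<in> fac s" "x \<in> e" "x \<in> e'" for e e' s x
    using perfect_matching_disjoint[OF pm that(1,2)] that(3,4) by blast
  have mem: "\<exists>j<2 * k. u j \<in> e" if "e \<in> fac s" for e s
  proof -
    have "e \<subseteq> V" "card e = 2" using perfect_matching_edge[OF pm that] by auto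
    then have "e \<noteq> {}" by auto
    then obtain x where "x \<in> e" "x \<in> V" using \<open>e \<subseteq> V\<close> by blast
    then show ?thesis using img by blast
  qed
  have D: "fac 2 \<union> fac (m - 2) = (\<lambda>j. {u j, u (j + 1)}) ` {..<2 * k}"
  proof
    show "(\<lambda>j. {u j, u (j + 1)}) ` {..<2 * k} \<subseteq> fac 2 \<union> fac (m - 2)"
    proof
      fix e assume "e \<in> (\<lambda>j. {u j, u (j + 1)}) ` {..<2 * k}"
      then obtain j where "j < 2 * k" "e = {u j, u (j + 1)}" by blast
      then show "e \<in> fac 2 \<union> fac (m - 2)" using edge[of j] by (auto split: if_splits)
    qed
    show "fac 2 \<union> fac (m - 2) \<subseteq> (\<lambda>j. {u j, u (j + 1)}) ` {..<2 * k}"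
    proof
      fix e assume "e \<in> fac 2 \<union> fac (m - 2)"
      \<comment> \<open>The parity of \<open>p\<close> records which of the two colours
        \<open>e\<close> has.\<close>
      then obtain p where p: "e \<in> fac (if even (p::nat) then 2 else m - 2)"
        by (metis UnE even_zero odd_one)
      obtain j where j: "j < 2 * k" "u j \<in> e" using mem[OF p] by blast
      \<comment> \<open>The two cycle edges at \<open>u j\<close> start at \<open>j\<close> and at
        its predecessor; \<open>i\<close> is the start with the parity of the colour. At
        \<open>j = 0\<close> the predecessor is \<open>2 * k - 1\<close>, and parities still
        alternate because the cycle has even length.\<close>
      define i where "i = (if even j = even p then j else if j = 0 then 2 * k - 1 else j - 1)"
      have i: "i < 2 * k" "even i = even p" using j(1) k by (auto simp: i_def)
      have "u j \<in> {u i, u (i + 1)}" using period[of 0] k by (auto simp: i_def)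
      then have "e = {u i, u (i + 1)}" using uniq[OF p _ j(2)] edge[OF i(1)] i(2) by simp
      then show "e \<in> (\<lambda>j. {u j, u (j + 1)}) ` {..<2 * k}" using i(1) by blast
    qed
  qed
  have A: "fac 0 = ch ` {..<k}"
  proof
    show "ch ` {..<k} \<subseteq> fac 0" using chord by blast
    show "fac 0 \<subseteq> ch ` {..<k}"
    proof
      fix e assume e: "e \<in> fac 0"
      obtain j where j: "j < 2 * k" "u j \<in> e" using mem[OF e] by blast
      \<comment> \<open>Positions \<open>j\<close> and \<open>2 * k - j\<close> lie on one chord,
        and so do \<open>0\<close> and \<open>k\<close>; \<open>i\<close> is the index below
        \<open>k\<close> that names it.\<close>
      define i where "i = (if j < k then j else if j = k then 0 else 2 * k - j)"
      have i: "i < k" using j(1) k by (auto simp: i_def)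
      have "u j \<in> ch i" using j(1) by (auto simp: i_def ch_def)
      then have "e = ch i" using uniq[OF e chord[OF i] j(2)] by simp
      then show "e \<in> ch ` {..<k}" using i by blast
    qed
  qed
  have inj: "inj_on fac {0..<m}" unfolding fac_def m_def by (rule factor_inj[OF k lab])
  have lad: "ladder k V u (fac 0) (fac 2 \<union> fac (m - 2))"
    unfolding ladder_def D using A ham_inj[OF k lab] img period unfolding u_def ch_def by simp
  have neq: "fac 0 \<noteq> fac 2" "fac 0 \<noteq> fac (m - 2)" "fac 2 \<noteq> fac (m - 2)"
  proof -
    \<comment> \<open>Colours \<open>2\<close> and \<open>m - 2\<close> could coincide only for
      \<open>m = 4\<close>, but \<open>m\<close> is odd.\<close>
    have "m \<noteq> 4" unfolding m_def by presburger
    then show "fac 0 \<noteq> fac 2" "fac 0 \<noteq> fac (m - 2)" "fac 2 \<noteq> fac (m - 2)"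
      using inj_onD[OF inj, of 0 2] inj_onD[OF inj, of 0 "m - 2"] inj_onD[OF inj, of 2 "m - 2"] m by auto
  qed
  have card: "card (fac ` {0..<m}) = 2 * k - 1" using card_image[OF inj] m_def by simp
  have "pairwise disjnt (fac ` {0..<m})"
  proof (rule pairwise_imageI)
    fix s t assume "s \<in> {0..<m}" "t \<in> {0..<m}" "s \<noteq> t"
    then show "disjnt (fac s) (fac t)"
      using factor_disjoint_sets[OF k lab] unfolding fac_def m_def disjnt_def by simp
  qed
  then have mat: "matchings V (fac ` {0..<m})"
    using pm by (auto simp: matchings_def)
  have un: "\<Union>(fac ` {0..<m}) = nsets V 2"
    unfolding fac_def m_def by (rule factor_Union[OF k lab])
  have "{fac 0, fac 2, fac (m - 2)} \<subseteq> fac ` {0..<m}" using m by auto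
  from that[OF mat card un this neq lad] show thesis .
qed

section \<open>Three factors forming a ladder\<close>

text \<open>The trail is cut into pieces of two adjacent edges, of excess one each; a last single
  edge also has excess one. Only the edges have to be distinct, vertices may recur.\<close>

lemma pack_trail:
  assumes "inj_on (\<lambda>j. {u j, u (Suc j)}) {i..<i + n}" "\<And>j. u j \<noteq> u (Suc j)"
  shows "pack V ((\<lambda>j. {u j, u (Suc j)}) ` {i..<i + n}) ((n + 1) div 2)"
  using assms(1)
proof (induction n rule: induct_nat_012)
  case 1
  show ?case using pack_edge[of "{u i, u (Suc i)}" V] assms(2)[of i] by simp
next
  case (ge2 n)
  define e where "e = (\<lambda>j. {u j, u (Suc j)})"
  have inj: "inj_on e {i..<i + Suc (Suc n)}" using ge2.prems by (simp add: e_def)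
  have "pack V (e ` {i..<i + n}) ((n + 1) div 2)"
    using ge2.IH(1) inj_on_subset[OF inj, of "{i..<i + n}"] by (auto simp: e_def)
  moreover have ne: "e (i + n) \<noteq> e (Suc (i + n))"
    using inj_onD[OF inj, of "i + n" "Suc (i + n)"] by auto
  have "pack V {e (i + n), e (Suc (i + n))} 1"
  proof (rule pack_path3)
    show "card (e (i + n)) = 2" "card (e (Suc (i + n))) = 2"
      using assms(2)[of "i + n"] assms(2)[of "Suc (i + n)"] by (simp_all add: e_def)
    show "e (i + n) \<inter> e (Suc (i + n)) \<noteq> {}" by (auto simp: e_def)
  qed (rule ne)
  moreover have "e ` {i..<i + n} \<inter> {e (i + n), e (Suc (i + n))} = {}"
  proof -
    have "e j \<notin> e ` {i..<i + n}" if "j = i + n \<or> j = Suc (i + n)" for j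
      using that by (subst inj_on_image_mem_iff[OF inj]) auto
    then show ?thesis by blast
  qed
  ultimately have "pack V (e ` {i..<i + n} \<union> {e (i + n), e (Suc (i + n))}) ((n + 1) div 2 + 1)"
    by (rule pack_Un)
  moreover have "e ` {i..<i + n} \<union> {e (i + n), e (Suc (i + n))} = e ` {i..<i + Suc (Suc n)}"
    by (simp add: atLeastLessThanSuc insert_commute)
  ultimately show ?case by (simp add: e_def)
qed simp

lemma star_inside_disjoint: "z \<notin> V \<Longrightarrow> E \<subseteq> Pow V \<Longrightarrow> star z S \<inter> E = {}"
  by (auto simp: star_def)

lemma perfect_matching_Pow: "perfect_matching V F \<Longrightarrow> F \<subseteq> Pow V"
  using perfect_matching_edge(2) by blast

context
  fixes k :: nat and V :: "'a set" and A B C :: "'a set set" and u :: "nat \<Rightarrow> 'a"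
  assumes finV: "finite V" and cardV: "card V = 2 * k" and k: "k \<ge> 2"
    and A: "perfect_matching V A" and B: "perfect_matching V B" and C: "perfect_matching V C"
    and AB: "A \<inter> B = {}" and AC: "A \<inter> C = {}" and BC: "B \<inter> C = {}"
    and ladder: "ladder k V u A (B \<union> C)"
begin

definition rim :: "nat \<Rightarrow> 'a set" where "rim j = {u j, u (Suc j)}"
definition rung :: "nat \<Rightarrow> 'a set" where "rung j = {u j, u (if j = 0 then k else 2 * k - j)}"

lemma rim_eq: "rim = (\<lambda>j. {u j, u (Suc j)})"
  by (simp add: rim_def fun_eq_iff)

lemma ladder_facts:
  shows u_inj: "inj_on u {..<2 * k}" and u_period: "u (j + 2 * k) = u j"
    and rim_image: "rim ` {..<2 * k} = B \<union> C" and rung_image: "rung ` {..<k} = A"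
  using ladder by (auto simp: ladder_def rim_def rung_def)

lemma card_matchings: "card A = k" "card B = k" "card C = k"
  using perfect_matching_card[OF finV A] perfect_matching_card[OF finV B]
    perfect_matching_card[OF finV C] cardV by simp_all

text \<open>Counting avoids a case analysis on indices: \<open>k\<close> indices are mapped onto the
  \<open>k\<close> edges of \<open>A\<close>.\<close>

lemma rung_inj: "inj_on rung {..<k}"
  using card_matchings(1) by (intro eq_card_imp_inj_on) (simp_all add: rung_image)

lemma rim_inj: "inj_on rim {..<2 * k}"
proof (rule eq_card_imp_inj_on)
  show "card (rim ` {..<2 * k}) = card {..<2 * k}"
    using card_matchings perfect_matching_finite[OF finV B] perfect_matching_finite[OF finV C]
    by (simp add: rim_image card_Un_disjoint[OF _ _ BC])
qed simp

lemma u_Suc_neq: "u j \<noteq> u (Suc j)"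
proof
  assume eq: "u j = u (Suc j)"
  have mod: "u i = u (i mod (2 * k))" for i
  proof -
    have "u (i mod (2 * k) + n * (2 * k)) = u (i mod (2 * k))" for n
    proof (induction n)
      case (Suc n)
      then show ?case using u_period[of "i mod (2 * k) + n * (2 * k)"] by (simp add: algebra_simps)
    qed simp
    from this[of "i div (2 * k)"] show ?thesis by (simp only: mod_div_mult_eq)
  qed
  have "j mod (2 * k) = Suc j mod (2 * k)"
    using eq mod[of j] mod[of "Suc j"] k by (intro inj_onD[OF u_inj]) auto
  then show False using k by (simp add: mod_Suc split: if_splits)
qed

lemma rung_edge:
  assumes "j < k"
  shows "card (rung j) = 2" "rung j \<subseteq> V"
  using perfect_matching_edge[OF A] rung_image assms by blast+

lemma rim_edge: "card (rim j) = 2" and rim_subset: "j < 2 * k \<Longrightarrow> rim j \<subseteq> V"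
  using u_Suc_neq[of j] perfect_matching_Pow[OF B] perfect_matching_Pow[OF C] rim_image
  by (auto simp: rim_def)

lemma rung_disjoint: "i < k \<Longrightarrow> j < k \<Longrightarrow> i \<noteq> j \<Longrightarrow> rung i \<inter> rung j = {}"
  using perfect_matching_disjoint[OF A] rung_image inj_onD[OF rung_inj, of i j] by blast

lemma rung_rim_meet: "rung j \<inter> rim j \<noteq> {}"
  by (auto simp: rung_def rim_def)

lemma rung_rim_disjoint: "I \<subseteq> {..<k} \<Longrightarrow> J \<subseteq> {..<2 * k} \<Longrightarrow> rung ` I \<inter> rim ` J = {}"
proof -
  assume "I \<subseteq> {..<k}" "J \<subseteq> {..<2 * k}"
  then have "rung ` I \<subseteq> A" "rim ` J \<subseteq> B \<union> C"
    unfolding rung_image[symmetric] rim_image[symmetric] by (simp_all only: image_mono)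
  then show ?thesis using AB AC by blast
qed

lemma rim_disjoint:
  assumes "I \<subseteq> {..<2 * k}" "J \<subseteq> {..<2 * k}" "I \<inter> J = {}"
  shows "rim ` I \<inter> rim ` J = {}"
  unfolding inj_on_image_Int[OF rim_inj assms(1,2), symmetric] assms(3) by simp

lemma rim_Pow: "J \<subseteq> {..<2 * k} \<Longrightarrow> rim ` J \<subseteq> Pow V"
  using rim_subset by blast

lemma rung_Pow: "I \<subseteq> {..<k} \<Longrightarrow> rung ` I \<subseteq> Pow V"
  using rung_edge(2) by blast

lemma pack_rim_half: "pack V (rim ` {k..<2 * k}) ((k + 1) div 2)"
proof -
  have "inj_on rim {k..<k + k}" by (rule inj_on_subset[OF rim_inj]) auto
  from pack_trail[OF this[unfolded rim_eq] u_Suc_neq] show ?thesis by (simp add: rim_eq mult_2)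
qed

text \<open>Each rung forms a path with the rim edge of the same index, as both contain
  \<open>u j\<close>; the remaining half of the cycle is a trail of \<open>k\<close> edges. In total
  \<open>3k\<close> edges are cut into pieces of at most two, with only one single edge if
  \<open>k\<close> is odd. This settles the three factors when \<open>W\<close> is empty.\<close>

lemma pack_ladder: "pack V (A \<union> (B \<union> C)) (k + (k + 1) div 2)"
proof -
  have "pack V (rung ` {..<k} \<union> rim ` {..<k}) (card {..<k})"
    using rung_inj inj_on_subset[OF rim_inj, of "{..<k}"] rung_rim_disjoint[of "{..<k}" "{..<k}"]
      rung_edge rim_edge rung_rim_meet
    by (intro pack_path3_family) auto
  moreover have "(rung ` {..<k} \<union> rim ` {..<k}) \<inter> rim ` {k..<2 * k} = {}"
    using rim_disjoint[of "{..<k}" "{k..<2 * k}"] rung_rim_disjoint[of "{..<k}" "{k..<2 * k}"]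
    by (simp add: Int_Un_distrib2 ivl_disj_int subset_eq)
  ultimately have "pack V ((rung ` {..<k} \<union> rim ` {..<k}) \<union> rim ` {k..<2 * k}) (card {..<k} + (k + 1) div 2)"
    using pack_rim_half by (intro pack_Un)
  moreover have "rim ` {..<k} \<union> rim ` {k..<2 * k} = rim ` {..<2 * k}"
    by (simp add: image_Un[symmetric] ivl_disj_un)
  ultimately show ?thesis by (simp add: rung_image rim_image Un_assoc)
qed

text \<open>The rungs are disjoint and so can be the bases of the triangles at \<open>z\<close>,
  with the rim edge of the same index as pendant. The index set is kept general because one rung is
  later treated separately.\<close>

lemma pack_rungs_with_star:
  assumes "z \<notin> V" "I \<subseteq> {..<k}"
  shows "pack V (star z (\<Union>(rung ` I)) \<union> rung ` I \<union> rim ` I) 0"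
proof (rule pack_paw_family)
  show "finite I" using assms(2) finite_subset by blast
  show "inj_on rung I" using inj_on_subset[OF rung_inj assms(2)] .
  show "inj_on rim I" using assms(2) by (intro inj_on_subset[OF rim_inj]) auto
  show "rung ` I \<inter> rim ` I = {}" using assms(2) by (intro rung_rim_disjoint) auto
  show "card (rung i) = 2 \<and> card (rim i) = 2 \<and> rung i \<inter> rim i \<noteq> {} \<and> rung i \<subseteq> V \<and> rim i \<subseteq> V"
    if "i \<in> I" for i
  proof -
    have "i < k" "i < 2 * k" using that assms(2) by auto
    then show ?thesis using rung_edge[of i] rim_edge[of i] rim_subset[of i] rung_rim_meet[of i] by blast
  qed
  show "rung i \<inter> rung j = {}" if "i \<in> I" "j \<in> I" "i \<noteq> j" for i j
    using rung_disjoint[of i j] that assms(2) by auto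
qed (rule assms(1))

text \<open>Compared with \<open>pack_ladder\<close>, the edges at \<open>z\<close> turn the
  \<open>k\<close> paths into blocks without excess, so only the second half of the cycle
  contributes.\<close>

lemma pack_star_ladder:
  assumes "z \<notin> V"
  shows "pack V (star z V \<union> (A \<union> (B \<union> C))) ((k + 1) div 2)"
proof -
  have "pack V (star z V \<union> A \<union> rim ` {..<k}) 0"
    using pack_rungs_with_star[OF assms subset_refl] perfect_matching_Union[OF A]
    by (simp add: rung_image)
  moreover have "star z V \<inter> rim ` {k..<2 * k} = {}"
    by (rule star_inside_disjoint[OF assms rim_Pow]) auto
  then have "(star z V \<union> A \<union> rim ` {..<k}) \<inter> rim ` {k..<2 * k} = {}"
    using rim_disjoint[of "{..<k}" "{k..<2 * k}"] rung_rim_disjoint[of "{..<k}" "{k..<2 * k}"]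
    by (simp add: Int_Un_distrib2 ivl_disj_int subset_eq rung_image)
  ultimately have "pack V ((star z V \<union> A \<union> rim ` {..<k}) \<union> rim ` {k..<2 * k}) (0 + (k + 1) div 2)"
    using pack_rim_half by (intro pack_Un)
  moreover have "rim ` {..<k} \<union> rim ` {k..<2 * k} = rim ` {..<2 * k}"
    by (simp add: image_Un[symmetric] ivl_disj_un)
  ultimately show ?thesis by (simp add: rim_image Un_assoc)
qed

text \<open>
  For odd \<open>k\<close> the rim edge at \<open>u 0\<close> extends the even trail left over, so that the block of the rung
  at \<open>u 0\<close> has room for a pendant edge.
\<close>

lemma pack_star_ladder_pendant:
  assumes "z \<notin> V" "z' \<notin> V" "z \<noteq> z'" "odd k"
  shows "pack V (star z V \<union> (A \<union> (B \<union> C)) \<union> {{z, z'}}) ((k + 1) div 2)"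
proof -
  \<comment> \<open>Index \<open>2 * k\<close> names the same rim edge as index \<open>0\<close>.
    Going on to it keeps the indices of the trail consecutive and gives it \<open>k + 1\<close>
    edges, an even number.\<close>
  have img: "rim ` {k..<k + (k + 1)} = rim ` (insert 0 {k..<2 * k})"
  proof -
    have "rim (2 * k) = rim 0" using u_period[of 0] u_period[of 1] by (simp add: rim_def)
    moreover have "{k..<k + (k + 1)} = insert (2 * k) {k..<2 * k}" by auto
    ultimately show ?thesis by simp
  qed
  have "inj_on rim {k..<k + (k + 1)}"
  proof (rule eq_card_imp_inj_on)
    have "card (rim ` (insert 0 {k..<2 * k})) = card (insert 0 {k..<2 * k})"
      using k by (intro card_image inj_on_subset[OF rim_inj]) auto
    then show "card (rim ` {k..<k + (k + 1)}) = card {k..<k + (k + 1)}"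
      unfolding img using k by simp
  qed simp
  then have "pack V (rim ` {k..<k + (k + 1)}) ((k + 1 + 1) div 2)"
    unfolding rim_eq by (intro pack_trail u_Suc_neq)
  \<comment> \<open>For odd \<open>k\<close> the longer trail costs no more, since
    \<open>(k + 2) div 2 = (k + 1) div 2\<close>.\<close>
  then have trail: "pack V (rim ` (insert 0 {k..<2 * k})) ((k + 1) div 2)"
    unfolding img using assms(4) by (elim oddE) simp
  have r0: "rung 0 \<subseteq> V" "card (rung 0) = 2" using rung_edge[of 0] k by auto
  have tri: "pack V (star z (rung 0) \<union> {rung 0, {z, z'}}) 0"
    using assms r0 by (intro pack_triangle_pendant) auto
  define P where "P = star z (\<Union>(rung ` {1..<k})) \<union> rung ` {1..<k} \<union> rim ` {1..<k}"
  have paws: "pack V P 0" unfolding P_def by (rule pack_rungs_with_star[OF assms(1)]) auto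
  have split: "{..<k} = insert 0 {1..<k}" using k by auto
  have un: "star z (rung 0) \<union> star z (\<Union>(rung ` {1..<k})) = star z V"
    using perfect_matching_Union[OF A] star_Un[of z "rung 0" "\<Union>(rung ` {1..<k})"]
    by (simp add: rung_image[symmetric] split)
  have d1: "P \<inter> (star z (rung 0) \<union> {rung 0, {z, z'}}) = {}"
  proof -
    have "{1..<k} \<subseteq> {..<k}" by auto
    from rung_Pow[OF this] have "(\<Union>(rung ` {1..<k})) \<subseteq> V" by auto
    moreover have "(\<Union>(rung ` {1..<k})) \<inter> rung 0 = {}" using rung_disjoint[of _ 0] k by fastforce
    ultimately have 1: "star z (\<Union>(rung ` {1..<k})) \<inter> star z (rung 0 \<union> {z'}) = {}"
      using assms r0 by (intro star_disjoint) auto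
    have 2: "star z S \<inter> {rung 0} = {}" for S using r0(1) assms(1) by (intro star_inside_disjoint) auto
    have 3: "star z S \<inter> (rung ` {1..<k} \<union> rim ` {1..<k}) = {}" for S
    proof (rule star_inside_disjoint[OF assms(1)])
      have "{1..<k} \<subseteq> {..<k}" "{1..<k} \<subseteq> {..<2 * k}" by auto
      then show "rung ` {1..<k} \<union> rim ` {1..<k} \<subseteq> Pow V" by (intro Un_least rung_Pow rim_Pow)
    qed
    have "rung 0 \<notin> rung ` {1..<k}" using k by (subst inj_on_image_mem_iff[OF rung_inj]) auto
    moreover have "rung 0 \<notin> rim ` {1..<k}"
    proof -
      have "{0} \<subseteq> {..<k}" "{1..<k} \<subseteq> {..<2 * k}" using k by auto
      from rung_rim_disjoint[OF this] show ?thesis by simp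
    qed
    ultimately have 4: "rung 0 \<notin> rung ` {1..<k} \<union> rim ` {1..<k}" by simp
    have "star z (rung 0) \<union> {rung 0, {z, z'}} = star z (rung 0 \<union> {z'}) \<union> {rung 0}"
      unfolding star_Un by auto
    moreover have "(Q \<union> I) \<inter> (S \<union> {r}) = {}"
      if "Q \<inter> S = {}" "Q \<inter> {r} = {}" "S \<inter> I = {}" "r \<notin> I" for Q I S and r :: "'a set"
      using that by blast
    from this[OF 1 2 3 4] have "P \<inter> (star z (rung 0 \<union> {z'}) \<union> {rung 0}) = {}"
      unfolding P_def Un_assoc .
    ultimately show ?thesis by simp
  qed
  have d2: "(P \<union> (star z (rung 0) \<union> {rung 0, {z, z'}})) \<inter> rim ` (insert 0 {k..<2 * k}) = {}"
  proof -
    have J: "insert 0 {k..<2 * k} \<subseteq> {..<2 * k}" using k by auto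
    define Z where "Z = rim ` (insert 0 {k..<2 * k})"
    have "star z S \<inter> Z = {}" for S
      unfolding Z_def by (rule star_inside_disjoint[OF assms(1) rim_Pow[OF J]])
    from this[of "\<Union>(rung ` {1..<k})"] this[of "rung 0"] this[of "{z'}"]
    have 1: "star z (\<Union>(rung ` {1..<k})) \<inter> Z = {}" "star z (rung 0) \<inter> Z = {}" "{z, z'} \<notin> Z"
      by simp_all
    have "rung ` {..<k} \<inter> Z = {}" unfolding Z_def by (intro rung_rim_disjoint J) simp
    then have 2: "rung ` {1..<k} \<inter> Z = {}" "rung 0 \<notin> Z" unfolding split by simp_all
    have 3: "rim ` {1..<k} \<inter> Z = {}" unfolding Z_def using J by (intro rim_disjoint) auto
    show ?thesis unfolding P_def Z_def[symmetric] by (simp add: Int_Un_distrib2 1 2 3 del: One_nat_def)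
  qed
  have "pack V (P \<union> (star z (rung 0) \<union> {rung 0, {z, z'}}) \<union> rim ` (insert 0 {k..<2 * k})) (0 + 0 + (k + 1) div 2)"
    by (intro pack_Un paws tri trail d1 d2)
  moreover have "P \<union> (star z (rung 0) \<union> {rung 0, {z, z'}}) \<union> rim ` (insert 0 {k..<2 * k}) =
    star z V \<union> (A \<union> (B \<union> C)) \<union> {{z, z'}}"
  proof -
    have "rim ` {1..<k} \<union> rim ` (insert 0 {k..<2 * k}) = B \<union> C"
      unfolding rim_image[symmetric] image_Un[symmetric] using k by (intro arg_cong[of _ _ "(`) rim"]) auto
    moreover have "insert (rung 0) (rung ` {1..<k}) = A"
      unfolding rung_image[symmetric] split by simp
    ultimately show ?thesis unfolding P_def un[symmetric] by blast
  qed
  ultimately show ?thesis by simp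
qed

end

section \<open>Stars over families of matchings\<close>

definition stars :: "'a set \<Rightarrow> 'a set \<Rightarrow> 'a set set" where
  "stars T S = (\<Union>z\<in>T. star z S)"

lemma stars_empty [simp]: "stars {} S = {}"
  and stars_insert [simp]: "stars (insert z T) S = star z S \<union> stars T S"
  and stars_Un: "stars (T \<union> T') S = stars T S \<union> stars T' S"
  by (auto simp: stars_def)

lemma stars_disjoint:
  "T \<inter> V = {} \<Longrightarrow> T' \<inter> V = {} \<Longrightarrow> T \<inter> T' = {} \<Longrightarrow> stars T V \<inter> stars T' V = {}"
  by (auto simp: stars_def star_def doubleton_eq_iff)

lemma stars_inside_disjoint: "T \<inter> V = {} \<Longrightarrow> E \<subseteq> Pow V \<Longrightarrow> stars T V \<inter> E = {}"
  by (auto simp: stars_def star_def)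

lemma stars_outside_disjoint: "W \<inter> V = {} \<Longrightarrow> E \<subseteq> Pow W \<Longrightarrow> stars T V \<inter> E = {}"
  by (auto simp: stars_def star_def)

lemma nsets_2_disjoint:
  assumes "W \<inter> V = {}" "E \<subseteq> Pow V" "E' \<subseteq> nsets W 2"
  shows "E \<inter> E' = {}"
proof (rule ccontr)
  assume "E \<inter> E' \<noteq> {}"
  then obtain e where e: "e \<in> E" "e \<in> nsets W 2" using assms(3) by blast
  then have "e \<subseteq> W" "e \<noteq> {}" by (auto simp: nsets_def)
  moreover have "e \<subseteq> V" using e(1) assms(2) by blast
  ultimately show False using assms(1) by blast
qed

lemma complete_graph_split:
  assumes "W \<inter> V = {}"
  shows "nsets (V \<union> W) 2 = nsets V 2 \<union> stars W V \<union> nsets W 2"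
proof
  show "nsets (V \<union> W) 2 \<subseteq> nsets V 2 \<union> stars W V \<union> nsets W 2"
  proof
    fix e assume "e \<in> nsets (V \<union> W) 2"
    then obtain x y where "e = {x, y}" "x \<in> V \<union> W" "y \<in> V \<union> W" "x \<noteq> y" by (auto simp: nsets_2_eq)
    moreover have "{x, y} \<in> stars W V" if "x \<in> W" "y \<in> V" for x y
      using that by (auto simp: stars_def star_def)
    from this[of x y] this[of y x] calculation show "e \<in> nsets V 2 \<union> stars W V \<union> nsets W 2"
      by (auto simp: insert_commute)
  qed
  show "nsets V 2 \<union> stars W V \<union> nsets W 2 \<subseteq> nsets (V \<union> W) 2"
    using assms nsets_mono[of V "V \<union> W" 2] nsets_mono[of W "V \<union> W" 2]
    by (auto simp: stars_def star_def)
qed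

lemma pack_outside:
  assumes "pack {} E e" "E \<subseteq> nsets W 2" "W \<inter> V = {}"
  shows "pack V E e"
proof -
  have "{x \<in> E. x \<subseteq> V} = {}"
    using nsets_2_disjoint[OF assms(3) subset_refl assms(2)] by blast
  then have "card {x \<in> E. x \<subseteq> V} \<le> 2" by (simp only: card.empty)
  then show ?thesis by (rule pack_restrict[OF assms(1)])
qed

lemma matchings_subset: "matchings V \<F> \<Longrightarrow> \<G> \<subseteq> \<F> \<Longrightarrow> matchings V \<G>"
  unfolding matchings_def by (meson finite_subset pairwise_subset subsetD)

lemma matchings_Union_Pow: "matchings V \<F> \<Longrightarrow> \<Union>\<F> \<subseteq> Pow V"
  unfolding matchings_def using perfect_matching_Pow by blast

lemma matchings_disjoint:
  assumes "matchings V \<F>" "\<G> \<subseteq> \<F>" "\<H> \<subseteq> \<F>" "\<G> \<inter> \<H> = {}"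
  shows "\<Union>\<G> \<inter> \<Union>\<H> = {}"
proof -
  have "F \<inter> H = {}" if "F \<in> \<G>" "H \<in> \<H>" for F H
    using assms that unfolding matchings_def pairwise_def disjnt_def by (metis disjoint_iff subsetD)
  then show ?thesis by blast
qed

lemma matchings_pairE:
  assumes "matchings V \<F>" "card \<F> = Suc (Suc n)"
  obtains F G \<H> where "\<F> = insert F (insert G \<H>)"
    "perfect_matching V F" "perfect_matching V G" "F \<inter> G = {}" "matchings V \<H>" "card \<H> = n"
    "(F \<union> G) \<inter> \<Union>\<H> = {}"
proof -
  obtain F \<F>' where F: "\<F> = insert F \<F>'" "F \<notin> \<F>'" "card \<F>' = Suc n"
    using assms(2) by (metis card_Suc_eq)
  then obtain G \<H> where G: "\<F>' = insert G \<H>" "G \<notin> \<H>" "card \<H> = n"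
    by (metis card_Suc_eq)
  have "(F \<union> G) \<inter> \<Union>\<H> = {}"
    using matchings_disjoint[OF assms(1), of "{F, G}" \<H>] F G by auto
  moreover have "F \<inter> G = {}"
    using matchings_disjoint[OF assms(1), of "{F}" "{G}"] F G by auto
  moreover have "matchings V \<H>" using matchings_subset[OF assms(1), of \<H>] F G by auto
  moreover have "perfect_matching V F" "perfect_matching V G"
    using assms(1) F G by (auto simp: matchings_def)
  ultimately show ?thesis using that[of F G \<H>] F G by auto
qed

lemma pack_matchings:
  assumes "finite V" "card V = 2 * k" "matchings V \<F>" "card \<F> = 2 * r"
  shows "pack V (\<Union>\<F>) (r * k)"
  using assms(3,4)
proof (induction r arbitrary: \<F>)
  case 0
  then have "\<F> = {}" by (simp add: matchings_def)
  then show ?case by simp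
next
  case (Suc r)
  obtain F G \<H> where *: "\<F> = insert F (insert G \<H>)" "perfect_matching V F" "perfect_matching V G"
    "F \<inter> G = {}" "matchings V \<H>" "card \<H> = 2 * r" "(F \<union> G) \<inter> \<Union>\<H> = {}"
    using Suc.prems(2) by (auto elim: matchings_pairE[OF Suc.prems(1), of "2 * r"])
  have "card F = k" using perfect_matching_card[OF assms(1) *(2)] assms(2) by simp
  then have "pack V ((F \<union> G) \<union> \<Union>\<H>) (k + r * k)"
    using pack_two_matchings[OF assms(1) *(2-4)] Suc.IH[OF *(5,6)] *(7) by (intro pack_Un) auto
  then show ?case by (simp add: *(1) Un_assoc)
qed

lemma pack_stars_two_matchings:
  assumes "finite V" "finite T" "T \<inter> V = {}" "matchings V \<F>" "card \<F> = 2 * card T"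
  shows "pack V (stars T V \<union> \<Union>\<F>) 0"
  using assms(2-5)
proof (induction T arbitrary: \<F> rule: finite_induct)
  case empty
  then have "\<F> = {}" by (simp add: matchings_def)
  then show ?case by simp
next
  case (insert z T)
  obtain F G \<H> where *: "\<F> = insert F (insert G \<H>)" "perfect_matching V F" "perfect_matching V G"
    "F \<inter> G = {}" "matchings V \<H>" "card \<H> = 2 * card T" "(F \<union> G) \<inter> \<Union>\<H> = {}"
  proof -
    have "card \<F> = Suc (Suc (2 * card T))" using insert by simp
    then show ?thesis using that matchings_pairE[OF insert.prems(2)] by metis
  qed
  have z: "z \<notin> V" "T \<inter> V = {}" using insert.prems(1) by auto
  have FG: "F \<union> G \<subseteq> Pow V" using perfect_matching_Pow[OF *(2)] perfect_matching_Pow[OF *(3)] by blast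
  have "pack V (star z V \<union> F \<union> G) 0" by (rule pack_star_two_matchings[OF assms(1) *(2-4) z(1)])
  moreover have "pack V (stars T V \<union> \<Union>\<H>) 0" by (rule insert.IH[OF z(2) *(5,6)])
  moreover have "(star z V \<union> F \<union> G) \<inter> (stars T V \<union> \<Union>\<H>) = {}"
  proof -
    have "star z V \<inter> stars T V = {}"
      using stars_disjoint[of "{z}" V T] z insert.hyps(2) by simp
    moreover have "star z V \<inter> \<Union>\<H> = {}"
      by (rule star_inside_disjoint[OF z(1) matchings_Union_Pow[OF *(5)]])
    moreover have "stars T V \<inter> (F \<union> G) = {}" by (rule stars_inside_disjoint[OF z(2) FG])
    ultimately show ?thesis using *(7) by blast
  qed
  ultimately have "pack V ((star z V \<union> F \<union> G) \<union> (stars T V \<union> \<Union>\<H>)) (0 + 0)" by (rule pack_Un)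
  moreover have "(star z V \<union> F \<union> G) \<union> (stars T V \<union> \<Union>\<H>) = stars (insert z T) V \<union> \<Union>\<F>"
    by (simp add: *(1) ac_simps)
  ultimately show ?case by simp
qed

lemma pack_stars_matchings:
  assumes "finite V" "finite T" "T \<inter> V = {}" "matchings V \<F>" "card \<F> = card T"
  shows "pack V (stars T V \<union> \<Union>\<F>) 0"
  using assms(2-5)
proof (induction T arbitrary: \<F> rule: finite_induct)
  case empty
  then have "\<F> = {}" by (simp add: matchings_def)
  then show ?case by simp
next
  case (insert z T)
  then obtain F \<H> where F: "\<F> = insert F \<H>" "F \<notin> \<H>" "card \<H> = card T"
    by (auto simp: card_Suc_eq)
  have H: "matchings V \<H>" using matchings_subset[OF insert.prems(2), of \<H>] F(1) by auto
  have pF: "perfect_matching V F" using insert.prems(2) F(1) by (simp add: matchings_def)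
  have z: "z \<notin> V" "T \<inter> V = {}" using insert.prems(1) by auto
  have "pack V (star z V \<union> F) 0" using pack_star_matching[OF assms(1) pF z(1), of "{}"] by simp
  moreover have "pack V (stars T V \<union> \<Union>\<H>) 0" by (rule insert.IH[OF z(2) H F(3)])
  moreover have "(star z V \<union> F) \<inter> (stars T V \<union> \<Union>\<H>) = {}"
  proof -
    have "star z V \<inter> stars T V = {}"
      using stars_disjoint[of "{z}" V T] z insert.hyps(2) by simp
    moreover have "star z V \<inter> \<Union>\<H> = {}"
      by (rule star_inside_disjoint[OF z(1) matchings_Union_Pow[OF H]])
    moreover have "stars T V \<inter> F = {}" by (rule stars_inside_disjoint[OF z(2) perfect_matching_Pow[OF pF]])
    moreover have "F \<inter> \<Union>\<H> = {}" using matchings_disjoint[OF insert.prems(2), of "{F}" \<H>] F by auto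
    ultimately show ?thesis by blast
  qed
  ultimately have "pack V ((star z V \<union> F) \<union> (stars T V \<union> \<Union>\<H>)) (0 + 0)" by (rule pack_Un)
  moreover have "(star z V \<union> F) \<union> (stars T V \<union> \<Union>\<H>) = stars (insert z T) V \<union> \<Union>\<F>"
    by (simp add: F(1) ac_simps)
  ultimately show ?case by simp
qed

lemma pack_stars_even:
  assumes "finite V" "even (card V)" "finite R" "R \<inter> V = {}" "even (card R)"
  shows "pack V (stars R V) 0"
proof -
  obtain r where "card R = 2 * r" using assms(5) by (elim evenE)
  then show ?thesis using assms(3,4)
  proof (induction r arbitrary: R)
    case (Suc r)
    then have "card R = Suc (Suc (2 * r))" by simp
    then obtain z R1 where z: "R = insert z R1" "z \<notin> R1" "card R1 = Suc (2 * r)"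
      by (auto simp: card_Suc_eq)
    then obtain z' R2 where z': "R1 = insert z' R2" "z' \<notin> R2" "card R2 = 2 * r"
      by (auto simp: card_Suc_eq)
    have "pack V (star z V \<union> star z' V) 0"
      using Suc.prems z z' assms(1,2) by (intro pack_two_stars) auto
    moreover have "pack V (stars R2 V) 0" using Suc.prems z z' by (intro Suc.IH) auto
    moreover have "(star z V \<union> star z' V) \<inter> stars R2 V = {}"
      using stars_disjoint[of "{z, z'}" V R2] Suc.prems z z' by auto
    ultimately have "pack V ((star z V \<union> star z' V) \<union> stars R2 V) (0 + 0)" by (rule pack_Un)
    then show ?case by (simp add: z(1) z'(1) Un_assoc)
  qed auto
qed

text \<open>Without two edges at \<open>z\<close>, what remains of \<open>K_4\<close> is a triangle
  with a pendant edge at the fourth vertex \<open>z\<close>. The two removed edges share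
  \<open>z\<close>, so they can either hang from triangles at \<open>z\<close> or form a path of
  excess one.\<close>

lemma K4_minus_two_edges:
  assumes "card W = 4" "z \<in> W"
  obtains U where "U \<subseteq> W - {z}" "card U = 2" "pack {} (nsets W 2 - star z U) 0"
    "\<And>V. pack V (star z U) 1"
proof -
  have "card (W - {z}) = Suc (Suc (Suc 0))" using assms by simp
  then obtain a b c where abc: "W - {z} = {a, b, c}" "a \<noteq> b" "a \<noteq> c" "b \<noteq> c"
    by (auto simp: card_Suc_eq)
  then have W: "W = {z, a, b, c}" "z \<noteq> a" "z \<noteq> b" "z \<noteq> c" using assms(2) by auto
  have eq: "nsets W 2 - star z {a, b} = star c {a, b} \<union> {{a, b}, {c, z}}"
  proof -
    have 1: "nsets W 2 = star z {a, b} \<union> {{z, c}, {a, b}, {a, c}, {b, c}}"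
      unfolding W(1) nsets_2_eq using W(2-4) abc(2-4) by (simp add: insert_Diff_if insert_commute)
    have 2: "star z {a, b} \<inter> {{z, c}, {a, b}, {a, c}, {b, c}} = {}"
      using W(2-4) abc(2-4) by (simp add: doubleton_eq_iff)
    have 3: "{{z, c}, {a, b}, {a, c}, {b, c}} = star c {a, b} \<union> {{a, b}, {c, z}}"
      by (simp add: insert_commute)
    have "N - S = Q" if "N = S \<union> Q" "S \<inter> Q = {}" for N S Q :: "'a set set" using that by blast
    from this[OF 1 2] show ?thesis unfolding 3 .
  qed
  show ?thesis
  proof (rule that[of "{a, b}"])
    show "pack {} (nsets W 2 - star z {a, b}) 0"
      unfolding eq using abc W by (intro pack_triangle_pendant) auto
    show "pack V (star z {a, b}) 1" for V
      using pack_path3[of "{z, a}" "{z, b}" V] abc W by (auto simp: doubleton_eq_iff)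
  qed (use abc in auto)
qed

text \<open>The edges in \<open>star z U\<close> are those to be hung from the triangles over one
  matching of \<open>V\<close>. All of them meet \<open>z\<close>, and two are affordable once that
  matching has at least two edges.\<close>

lemma complete_minus_pendants:
  assumes "finite W" "z \<in> W" "card W \<noteq> 2 \<Longrightarrow> card W \<noteq> 4 \<Longrightarrow> pack {} (nsets W 2) 0"
  obtains U where "U \<subseteq> W - {z}" "card U \<le> 2" "pack {} (nsets W 2 - star z U) 0"
proof -
  consider "card W = 2" | "card W = 4" | "card W \<noteq> 2" "card W \<noteq> 4" by blast
  then show ?thesis
  proof cases
    case 1
    then obtain y where y: "W = {z, y}" "y \<noteq> z" using assms(2) by (auto simp: card_2_iff)
    have "nsets W 2 - star z {y} = {}" unfolding y(1) nsets_2_eq by auto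
    then show ?thesis using that[of "{y}"] y by simp
  next
    case 2
    then show ?thesis using K4_minus_two_edges[OF 2 assms(2)] that by (metis order_refl)
  next
    case 3
    then show ?thesis using that[of "{}"] assms(3) by simp
  qed
qed

section \<open>Optimal packings of complete graphs\<close>

lemma split_card:
  assumes "finite S" "n \<le> card S"
  obtains T R where "S = T \<union> R" "T \<inter> R = {}" "card T = n" "card R = card S - n" "finite T" "finite R"
proof -
  obtain T where T: "T \<subseteq> S" "card T = n" using obtain_subset_with_card_n[OF assms(2)] by blast
  then have "card (S - T) = card S - n" using assms(1) by (simp add: card_Diff_subset finite_subset)
  then show ?thesis using that[of T "S - T"] T assms(1) by (auto intro: finite_subset)
qed

text \<open>This is used for the theorem and, with \<open>k = 2\<close>, as the induction step for
  plain complete graphs; therefore a packing of the graph on \<open>W\<close> is a hypothesis,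
  conditional on its size.\<close>

lemma pack_complete_graph_large_outside:
  fixes V W :: "'a set"
  assumes "finite V" "card V = 2 * k" "k \<ge> 2" "finite W" "W \<inter> V = {}" "k \<le> card W"
    "card W \<noteq> 2 \<Longrightarrow> card W \<noteq> 4 \<Longrightarrow> pack {} (nsets W 2) 0"
  shows "pack V (nsets (V \<union> W) 2) 0"
proof -
  obtain \<F> where fac: "matchings V \<F>" "card \<F> = 2 * k - 1" "\<Union>\<F> = nsets V 2"
    using one_factorization_with_ladder[OF assms(1-3)] by metis
  define w where "w = card W"
  \<comment> \<open>Here \<open>t\<close> vertices of \<open>W\<close> absorb two matchings each,
    \<open>s\<close> vertices and \<open>z\<close> absorb one each, and the others must be even in
    number to form 4-cycles. If \<open>w \<le> 2 * k - 1\<close>, the choice uses up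
    \<open>W\<close>, and \<open>k \<le> w\<close> keeps \<open>s\<close> nonnegative. For larger
    \<open>w\<close> one matching per vertex would occupy \<open>2 * k - 1\<close> vertices; if
    \<open>w\<close> is even, one vertex takes two matchings to correct the parity.\<close>
  define t where "t = (if w \<le> 2 * k - 1 then 2 * k - 1 - w else if even w then 1 else 0)"
  define s where "s = 2 * k - 2 - 2 * t"
  have ts: "2 * t + s + 1 = 2 * k - 1" "t + s + 1 \<le> w" "even (w - (t + s + 1))"
    using assms(3,6) unfolding s_def t_def w_def[symmetric] by (auto elim!: oddE evenE)
  obtain z where z: "z \<in> W" using assms(3,6) by fastforce
  obtain U where U: "U \<subseteq> W - {z}" "card U \<le> 2" "pack {} (nsets W 2 - star z U) 0"
    using complete_minus_pendants[OF assms(4) z assms(7)] .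
  have cW: "card (W - {z}) = w - 1" using z by (simp add: w_def)
  then have tw: "t \<le> card (W - {z})" using ts(2) by simp
  then obtain T Q where T: "W - {z} = T \<union> Q" "T \<inter> Q = {}" "card T = t" "card Q = w - 1 - t" "finite T" "finite Q"
    using split_card[OF _ tw] assms(4) cW by (metis finite_Diff)
  obtain S R where S: "Q = S \<union> R" "S \<inter> R = {}" "card S = s" "card R = w - 1 - t - s" "finite S" "finite R"
  proof -
    have "s \<le> card Q" using T(4) ts(2) by simp
    then show ?thesis using that split_card[OF T(6)] T(4) by metis
  qed
  have fin: "finite \<F>" using fac(1) by (simp add: matchings_def)
  obtain \<T> \<Q> where \<T>: "\<F> = \<T> \<union> \<Q>" "\<T> \<inter> \<Q> = {}" "card \<T> = 2 * t" "card \<Q> = 2 * k - 1 - 2 * t" "finite \<Q>"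
  proof -
    have "2 * t \<le> card \<F>" using fac(2) ts(1) by simp
    then show ?thesis using that split_card[OF fin] fac(2) by metis
  qed
  obtain \<S> \<O> where \<S>: "\<Q> = \<S> \<union> \<O>" "\<S> \<inter> \<O> = {}" "card \<S> = s" "card \<O> = 2 * k - 1 - 2 * t - s"
  proof -
    have "s \<le> card \<Q>" using \<T>(4) ts(1) by simp
    then show ?thesis using that split_card[OF \<T>(5)] \<T>(4) by metis
  qed
  have "card \<O> = 1" using \<S>(4) ts(1) by simp
  then obtain F where F: "\<O> = {F}" by (auto simp: card_1_singleton_iff)
  have pF: "perfect_matching V F" using fac(1) \<T>(1) \<S>(1) F by (auto simp: matchings_def)
  have sub: "\<T> \<subseteq> \<F>" "\<S> \<subseteq> \<F>" "{F} \<subseteq> \<F>" using \<T>(1) \<S>(1) F by auto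
  have W: "z \<notin> V" "T \<inter> V = {}" "S \<inter> V = {}" "R \<inter> V = {}" "U \<inter> V = {}" "z \<notin> U" "finite U"
    using assms(4,5) z T(1) S(1) U(1) by (auto intro: finite_subset)
  have zTSR: "z \<notin> T" "z \<notin> S" "z \<notin> R" "T \<inter> S = {}" "T \<inter> R = {}" using T(1,2) S(1) by auto

  have p1: "pack V (star z V \<union> F \<union> star z U) 0"
    using U(2) assms(2,3) perfect_matching_card[OF assms(1) pF] W
    by (intro pack_star_matching[OF assms(1) pF]) auto
  have p2: "pack V (stars T V \<union> \<Union>\<T>) 0"
    using pack_stars_two_matchings[OF assms(1) T(5) W(2) matchings_subset[OF fac(1) sub(1)]] T(3) \<T>(3) by simp
  have p3: "pack V (stars S V \<union> \<Union>\<S>) 0"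
    using pack_stars_matchings[OF assms(1) S(5) W(3) matchings_subset[OF fac(1) sub(2)]] S(3) \<S>(3) by simp
  have p4: "pack V (stars R V) 0"
    using ts(3) assms(2) S(4) by (intro pack_stars_even[OF assms(1) _ S(6) W(4)]) (simp_all add: diff_diff_left)
  have p5: "pack V (nsets W 2 - star z U) 0"
    by (rule pack_outside[OF U(3) _ assms(5)]) auto

  have Pow: "\<Union>\<T> \<subseteq> Pow V" "\<Union>\<S> \<subseteq> Pow V" "F \<subseteq> Pow V"
    using matchings_Union_Pow[OF matchings_subset[OF fac(1) sub(1)]]
      matchings_Union_Pow[OF matchings_subset[OF fac(1) sub(2)]] perfect_matching_Pow[OF pF] by auto
  have zU: "star z U \<subseteq> nsets W 2" "star z U \<subseteq> Pow W" using U(1) z by (auto simp: star_def)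
  have nW: "nsets W 2 - star z U \<subseteq> nsets W 2" "nsets W 2 - star z U \<subseteq> Pow W" by (auto simp: nsets_def)
  have ss: "star z V \<inter> stars T V = {}" "star z V \<inter> stars S V = {}" "star z V \<inter> stars R V = {}"
    using stars_disjoint[of "{z}" V T] stars_disjoint[of "{z}" V S] stars_disjoint[of "{z}" V R] W zTSR by auto
  have ss': "stars T V \<inter> stars S V = {}" "stars T V \<inter> stars R V = {}" "stars S V \<inter> stars R V = {}"
    using stars_disjoint[of T V S] stars_disjoint[of T V R] stars_disjoint[of S V R] W zTSR S(2) by auto
  note si = stars_inside_disjoint[OF W(2)] stars_inside_disjoint[OF W(3)] stars_inside_disjoint[OF W(4)]
    stars_inside_disjoint[of "{z}", simplified, OF W(1)]
  note so = stars_outside_disjoint[OF assms(5)] stars_outside_disjoint[OF assms(5), of _ "{z}", simplified]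
  note nn = nsets_2_disjoint[OF assms(5)]
  have FF: "\<Union>\<T> \<inter> \<Union>\<S> = {}" "\<Union>\<T> \<inter> F = {}" "\<Union>\<S> \<inter> F = {}"
    using matchings_disjoint[OF fac(1) sub(1,2)] matchings_disjoint[OF fac(1) sub(1,3)]
      matchings_disjoint[OF fac(1) sub(2,3)] \<T>(2) \<S>(1,2) F by auto

  note dj = ss ss' FF si(4)[OF Pow(1)] si(4)[OF Pow(2)] si(1)[OF Pow(2)] si(1)[OF Pow(3)]
    si(2)[OF Pow(1)] si(2)[OF Pow(3)] si(3)[OF Pow(1)] si(3)[OF Pow(2)] si(3)[OF Pow(3)]
    so(1)[OF zU(2), of T] so(1)[OF zU(2), of S] so(1)[OF zU(2), of R] nn[OF Pow(1) zU(1)] nn[OF Pow(2) zU(1)]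
    so(2)[OF nW(2)] so(1)[OF nW(2), of T] so(1)[OF nW(2), of S] so(1)[OF nW(2), of R]
    nn[OF Pow(1) nW(1)] nn[OF Pow(2) nW(1)] nn[OF Pow(3) nW(1)] Diff_disjoint[of "star z U" "nsets W 2"]
  note djs = dj dj[THEN trans[OF Int_commute]] Int_Un_distrib Int_Un_distrib2 Un_empty_left
  have d2: "(star z V \<union> F \<union> star z U) \<inter> (stars T V \<union> \<Union>\<T>) = {}"
    by (simp only: djs)
  have d3: "(star z V \<union> F \<union> star z U \<union> (stars T V \<union> \<Union>\<T>)) \<inter> (stars S V \<union> \<Union>\<S>) = {}"
    by (simp only: djs)
  have d4: "(star z V \<union> F \<union> star z U \<union> (stars T V \<union> \<Union>\<T>) \<union> (stars S V \<union> \<Union>\<S>)) \<inter> stars R V = {}"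
    by (simp only: djs)
  have d5: "(star z V \<union> F \<union> star z U \<union> (stars T V \<union> \<Union>\<T>) \<union> (stars S V \<union> \<Union>\<S>) \<union> stars R V)
      \<inter> (nsets W 2 - star z U) = {}"
    by (simp only: djs)
  have "pack V (star z V \<union> F \<union> star z U \<union> (stars T V \<union> \<Union>\<T>) \<union> (stars S V \<union> \<Union>\<S>) \<union> stars R V
      \<union> (nsets W 2 - star z U)) (0 + 0 + 0 + 0 + 0)"
    by (intro pack_Un p1 p2 p3 p4 p5 d2 d3 d4 d5)
  moreover have "star z V \<union> F \<union> star z U \<union> (stars T V \<union> \<Union>\<T>) \<union> (stars S V \<union> \<Union>\<S>) \<union> stars R V
      \<union> (nsets W 2 - star z U) = nsets (V \<union> W) 2"
  proof -
    have "W = insert z (T \<union> (S \<union> R))" using z T(1) S(1) by blast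
    then have "stars W V = star z V \<union> stars T V \<union> stars S V \<union> stars R V"
      by (simp add: stars_Un Un_assoc)
    moreover have "nsets V 2 = F \<union> \<Union>\<T> \<union> \<Union>\<S>"
      unfolding fac(3)[symmetric] \<T>(1) \<S>(1) F by auto
    moreover have "nsets W 2 = star z U \<union> (nsets W 2 - star z U)" using zU(1) by blast
    ultimately show ?thesis unfolding complete_graph_split[OF assms(5)] by blast
  qed
  ultimately show ?thesis by simp
qed

section \<open>Complete graphs without a distinguished subset\<close>

lemma pack_K3:
  assumes "card X = 3"
  shows "pack {} (nsets X 2) 0"
proof -
  obtain x y z where X: "X = {x, y, z}" "x \<noteq> y" "x \<noteq> z" "y \<noteq> z"
    using assms by (auto simp: card_3_iff)
  have "nsets X 2 = star z {x, y} \<union> {{x, y}}"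
    unfolding X(1) nsets_2_eq using X(2-4) by (simp add: insert_Diff_if insert_commute)
  then show ?thesis using pack_triangle[of "{x, y}" z "{}"] X by simp
qed

text \<open>The blocks are two triangles with common vertex \<open>a\<close> and the 4-cycle between
  their opposite edges.\<close>

lemma pack_K5:
  assumes "card X = 5"
  shows "pack {} (nsets X 2) 0"
proof -
  have "finite X" using assms by (simp add: card_ge_0_finite)
  then obtain xs where xs: "set xs = X" "distinct xs" using finite_distinct_list by blast
  then have "length xs = 5" using assms distinct_card by metis
  then obtain a b c d e where "xs = [a, b, c, d, e]"
    by (auto simp: length_Suc_conv eval_nat_numeral)
  then have X: "X = {a, b, c, d, e}"
    "a \<noteq> b" "a \<noteq> c" "a \<noteq> d" "a \<noteq> e" "b \<noteq> c" "b \<noteq> d" "b \<noteq> e" "c \<noteq> d" "c \<noteq> e" "d \<noteq> e"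
    using xs by auto
  have eq: "nsets X 2 = (star a {b, c} \<union> {{b, c}}) \<union> (star a {d, e} \<union> {{d, e}}) \<union> (star b {d, e} \<union> star c {d, e})"
    unfolding X(1) nsets_2_eq using X(2-) by (simp add: insert_Diff_if insert_commute)
  have "pack {} ((star a {b, c} \<union> {{b, c}}) \<union> (star a {d, e} \<union> {{d, e}}) \<union> (star b {d, e} \<union> star c {d, e})) (0 + 0 + 0)"
  proof (intro pack_Un)
    show "pack {} (star a {b, c} \<union> {{b, c}}) 0" "pack {} (star a {d, e} \<union> {{d, e}}) 0"
      using X(2-) by (intro pack_triangle; simp)+
    show "pack {} (star b {d, e} \<union> star c {d, e}) 0" using X(2-) by (intro pack_4_cycle) auto
    show "(star a {b, c} \<union> {{b, c}}) \<inter> (star a {d, e} \<union> {{d, e}}) = {}"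
      using X(2-) by (simp add: doubleton_eq_iff)
    show "(star a {b, c} \<union> {{b, c}} \<union> (star a {d, e} \<union> {{d, e}})) \<inter> (star b {d, e} \<union> star c {d, e}) = {}"
      using X(2-) by (simp add: doubleton_eq_iff)
  qed
  then show ?thesis by (simp only: eq add_0)
qed

text \<open>Splitting off four vertices requires at least two others, so \<open>3\<close> and
  \<open>5\<close> are base cases. For \<open>6\<close> and \<open>8\<close> vertices the rest has
  the exceptional size \<open>2\<close> or \<open>4\<close>, which the pendant edges take care
  of.\<close>

lemma pack_complete_graph:
  assumes "finite X" "card X = 3 \<or> card X \<ge> 5"
  shows "pack {} (nsets X 2) 0"
  using assms
proof (induction "card X" arbitrary: X rule: less_induct)
  case less
  consider "card X = 3" | "card X = 5" | "card X \<ge> 6" using less.prems(2) by linarith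
  then show ?case
  proof cases
    case 3
    then obtain V W where VW: "X = V \<union> W" "V \<inter> W = {}" "card V = 4" "card W = card X - 4" "finite V" "finite W"
      using split_card[OF less.prems(1), of 4] by auto
    have "pack V (nsets (V \<union> W) 2) 0"
    proof (rule pack_complete_graph_large_outside[of V 2 W])
      assume "card W \<noteq> 2" "card W \<noteq> 4"
      then have "card W = 3 \<or> card W \<ge> 5" using 3 VW(4) by auto
      then show "pack {} (nsets W 2) 0" using 3 VW(4,6) by (intro less.hyps) auto
    qed (use VW 3 in auto)
    then show ?thesis using pack_subset VW(1) by blast
  qed (use pack_K3 pack_K5 in auto)
qed

lemma pack_complete_graph_not_2_4:
  assumes "finite W" "card W \<noteq> 2" "card W \<noteq> 4"
  shows "pack {} (nsets W 2) 0"
proof (cases "card W \<le> 1")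
  case True
  then have "nsets W 2 = {}" using assms(1) by (simp add: nsets_eq_empty)
  then show ?thesis by simp
next
  case False
  then show ?thesis using assms by (intro pack_complete_graph) auto
qed

lemma pack_complete_graph_many_outside:
  assumes "finite V" "card V = 2 * k" "finite W" "W \<inter> V = {}" "k \<le> card W" "card V + card W \<ge> 5"
  shows "pack V (nsets (V \<union> W) 2) 0"
proof (cases "k \<ge> 2")
  case True
  then show ?thesis
    using assms pack_complete_graph_not_2_4[OF assms(3)]
    by (intro pack_complete_graph_large_outside[of V k W]) auto
next
  case False
  \<comment> \<open>Now \<open>V\<close> has at most two vertices and spans at most one edge, so the
    restriction is void.\<close>
  have "card (V \<union> W) \<ge> 5" using assms by (subst card_Un_disjoint) auto
  then have p: "pack {} (nsets (V \<union> W) 2) 0" using assms by (intro pack_complete_graph) auto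
  have "{x \<in> nsets (V \<union> W) 2. x \<subseteq> V} \<subseteq> nsets V 2" by (auto simp: nsets_def)
  then have "card {x \<in> nsets (V \<union> W) 2. x \<subseteq> V} \<le> card (nsets V 2)"
    using assms(1) by (intro card_mono finite_imp_finite_nsets)
  also have "\<dots> = 2 * k choose 2" using assms(2) by (simp add: card_nsets)
  also have "\<dots> \<le> 2"
  proof -
    have "k = 0 \<or> k = 1" using False by linarith
    then show ?thesis by (auto simp: binomial_eq_0)
  qed
  finally show ?thesis by (rule pack_restrict[OF p])
qed

lemma complete_graph_excess_1:
  assumes "finite W" "card W = 2 \<or> card W = 4"
  shows "pack {} (nsets W 2) 1"
  using assms(2)
proof
  assume "card W = 2"
  then obtain x y where "W = {x, y}" "x \<noteq> y" by (auto simp: card_2_iff)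
  then have "nsets W 2 = {{x, y}}" by (auto simp: nsets_2_eq)
  then show ?thesis using pack_edge[of "{x, y}"] \<open>x \<noteq> y\<close> by simp
next
  assume W: "card W = 4"
  then obtain z where z: "z \<in> W" by fastforce
  obtain U where U: "U \<subseteq> W - {z}" "pack {} (nsets W 2 - star z U) 0" "pack {} (star z U) 1"
    using K4_minus_two_edges[OF W z] by metis
  have "star z U \<subseteq> nsets W 2" using U(1) z by (auto simp: star_def)
  then have "nsets W 2 = (nsets W 2 - star z U) \<union> star z U" by blast
  moreover have "pack {} ((nsets W 2 - star z U) \<union> star z U) (0 + 1)"
    using U(2,3) by (intro pack_Un) auto
  ultimately show ?thesis by simp
qed

text \<open>The vertex \<open>z\<close> goes with the three ladder factors and every other vertex of
  \<open>W\<close> with two matchings; the \<open>2 * (k - 1 - card W)\<close> matchings left are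
  paired into paths. The parameters \<open>U\<close> and \<open>e\<close> leave open which edges of
  \<open>W\<close> hang from \<open>z\<close> and what the others cost.\<close>

lemma pack_small_outside_aux:
  fixes V W :: "'a set"
  assumes "finite V" "card V = 2 * k" "finite W" "W \<inter> V = {}" "card W + 1 \<le> k"
    and z: "z \<in> W" and U: "U \<subseteq> W - {z}" "pack {} (nsets W 2 - star z U) e"
    and fac: "matchings V \<F>" "card \<F> = 2 * k - 1" "\<Union>\<F> = nsets V 2" "{A, B, C} \<subseteq> \<F>"
      "A \<noteq> B" "A \<noteq> C" "B \<noteq> C"
    and p1: "pack V (star z V \<union> (A \<union> (B \<union> C)) \<union> star z U) ((k + 1) div 2)"
  shows "pack V (nsets (V \<union> W) 2) ((k + 1) div 2 + (k - 1 - card W) * k + e)"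
proof -
  define T where "T = W - {z}"
  define w where "w = card W"
  have T: "finite T" "T \<inter> V = {}" "card T = w - 1" "W = insert z T" "z \<notin> T"
    using assms(3,4) z by (auto simp: T_def w_def)
  have w: "1 \<le> w" using assms(3) z by (auto simp: w_def Suc_le_eq card_gt_0_iff)
  define \<D> where "\<D> = \<F> - {A, B, C}"
  have finD: "finite \<D>" using fac(1) by (simp add: \<D>_def matchings_def)
  have "card {A, B, C} = 3" using fac(5-7) by simp
  then have cD: "card \<D> = 2 * k - 4" using fac(2,4) by (simp add: \<D>_def card_Diff_subset)
  have "2 * (w - 1) \<le> card \<D>" using assms(5) cD w unfolding w_def by linarith
  then obtain \<T> \<R> where \<T>: "\<D> = \<T> \<union> \<R>" "\<T> \<inter> \<R> = {}" "card \<T> = 2 * (w - 1)"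
    "card \<R> = card \<D> - 2 * (w - 1)"
    using split_card[OF finD] by metis
  have cR: "card \<R> = 2 * (k - 1 - w)" using \<T>(4) cD w by simp
  have sub: "\<T> \<subseteq> \<F>" "\<R> \<subseteq> \<F>" using \<T>(1) \<D>_def by auto
  have dis: "{A, B, C} \<inter> \<T> = {}" "{A, B, C} \<inter> \<R> = {}" using \<T>(1) \<D>_def by auto
  have zV: "z \<notin> V" using assms(4) z by auto
  have p2: "pack V (stars T V \<union> \<Union>\<T>) 0"
    using pack_stars_two_matchings[OF assms(1) T(1,2) matchings_subset[OF fac(1) sub(1)]] T(3) \<T>(3) by simp
  have p3: "pack V (\<Union>\<R>) ((k - 1 - w) * k)"
    by (rule pack_matchings[OF assms(1,2) matchings_subset[OF fac(1) sub(2)] cR])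
  have p4: "pack V (nsets W 2 - star z U) e"
    by (rule pack_outside[OF U(2) _ assms(4)]) auto
  define M where "M = A \<union> (B \<union> C)"
  have UM: "\<Union>{A, B, C} = M" by (auto simp: M_def)
  have Pow: "\<Union>\<T> \<subseteq> Pow V" "\<Union>\<R> \<subseteq> Pow V" "M \<subseteq> Pow V"
    using matchings_Union_Pow[OF matchings_subset[OF fac(1) sub(1)]]
      matchings_Union_Pow[OF matchings_subset[OF fac(1) sub(2)]]
      matchings_Union_Pow[OF matchings_subset[OF fac(1) fac(4)]] unfolding UM by auto
  have zU: "star z U \<subseteq> nsets W 2" "star z U \<subseteq> Pow W" using U(1) z by (auto simp: star_def)
  have nW: "nsets W 2 - star z U \<subseteq> nsets W 2" "nsets W 2 - star z U \<subseteq> Pow W" by (auto simp: nsets_def)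
  have ss: "star z V \<inter> stars T V = {}" using stars_disjoint[of "{z}" V T] zV T by simp
  note si = stars_inside_disjoint[OF T(2)] star_inside_disjoint[OF zV]
  note so = stars_outside_disjoint[OF assms(4)] stars_outside_disjoint[OF assms(4), of _ "{z}", simplified]
  note nn = nsets_2_disjoint[OF assms(4)]
  have FF: "M \<inter> \<Union>\<T> = {}" "M \<inter> \<Union>\<R> = {}" "\<Union>\<T> \<inter> \<Union>\<R> = {}"
    using matchings_disjoint[OF fac(1,4) sub(1) dis(1)] matchings_disjoint[OF fac(1,4) sub(2) dis(2)]
      matchings_disjoint[OF fac(1) sub \<T>(2)] unfolding UM .
  note dj = ss FF si(2)[OF Pow(1)] si(2)[OF Pow(2)] si(1)[OF Pow(2)] si(1)[OF Pow(3)]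
    so(1)[OF zU(2), of T] nn[OF Pow(1) zU(1)] nn[OF Pow(2) zU(1)] so(2)[OF nW(2)] so(1)[OF nW(2), of T]
    nn[OF Pow(1) nW(1)] nn[OF Pow(2) nW(1)] nn[OF Pow(3) nW(1)] Diff_disjoint[of "star z U" "nsets W 2"]
  note djs = dj dj[THEN trans[OF Int_commute]] Int_Un_distrib Int_Un_distrib2 Un_empty_left
  have d2: "(star z V \<union> M \<union> star z U) \<inter> (stars T V \<union> \<Union>\<T>) = {}"
    by (simp only: djs)
  have d3: "(star z V \<union> M \<union> star z U \<union> (stars T V \<union> \<Union>\<T>)) \<inter> \<Union>\<R> = {}"
    by (simp only: djs)
  have d4: "(star z V \<union> M \<union> star z U \<union> (stars T V \<union> \<Union>\<T>) \<union> \<Union>\<R>) \<inter> (nsets W 2 - star z U) = {}"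
    by (simp only: djs)
  have "pack V (star z V \<union> M \<union> star z U \<union> (stars T V \<union> \<Union>\<T>) \<union> \<Union>\<R> \<union> (nsets W 2 - star z U))
      ((k + 1) div 2 + 0 + (k - 1 - w) * k + e)"
    by (intro pack_Un p1[folded M_def] p2 p3 p4 d2 d3 d4)
  moreover have "star z V \<union> M \<union> star z U \<union> (stars T V \<union> \<Union>\<T>) \<union> \<Union>\<R> \<union> (nsets W 2 - star z U)
      = nsets (V \<union> W) 2"
  proof -
    have "stars W V = star z V \<union> stars T V" by (simp add: T(4))
    moreover have "\<F> = {A, B, C} \<union> (\<T> \<union> \<R>)" using fac(4) \<T>(1) unfolding \<D>_def by blast
    then have "nsets V 2 = M \<union> \<Union>\<T> \<union> \<Union>\<R>"
      unfolding fac(3)[symmetric] M_def by auto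
    moreover have "nsets W 2 = star z U \<union> (nsets W 2 - star z U)" using zU(1) by blast
    ultimately show ?thesis unfolding complete_graph_split[OF assms(4)] by blast
  qed
  ultimately show ?thesis by (simp add: w_def)
qed

text \<open>For odd \<open>k\<close> the half of the cycle left over has an odd number of edges, and
  the excess lost in rounding up buys a place for one edge at \<open>z\<close>. That suffices
  exactly when \<open>W\<close> spans a single edge.\<close>

lemma pack_complete_graph_small_outside:
  assumes "finite V" "card V = 2 * k" "k \<ge> 2" "finite W" "W \<inter> V = {}" "card W + 1 \<le> k"
  shows "pack V (nsets (V \<union> W) 2) ((k + 1) div 2 + (k - 1 - card W) * k +
    (if card W = 4 \<or> card W = 2 \<and> even k then 1 else 0))"
proof -
  obtain \<F> A B C u where fac: "matchings V \<F>" "card \<F> = 2 * k - 1" "\<Union>\<F> = nsets V 2" "{A, B, C} \<subseteq> \<F>"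
      "A \<noteq> B" "A \<noteq> C" "B \<noteq> C" and lad: "ladder k V u A (B \<union> C)"
    using one_factorization_with_ladder[OF assms(1-3)] .
  have pm: "perfect_matching V A" "perfect_matching V B" "perfect_matching V C"
    using fac(1,4) by (auto simp: matchings_def)
  have dis: "A \<inter> B = {}" "A \<inter> C = {}" "B \<inter> C = {}"
    using fac(1,4-7) by (auto simp: matchings_def pairwise_def disjnt_def)
  note ladder = assms(1-3) pm dis lad
  show ?thesis
  proof (cases "W = {}")
    case True
    define \<D> where "\<D> = \<F> - {A, B, C}"
    have "card {A, B, C} = 3" using fac(5-7) by simp
    then have "card \<D> = 2 * (k - 2)" using fac(2,4) by (simp add: \<D>_def card_Diff_subset)
    then have "pack V (\<Union>\<D>) ((k - 2) * k)"
      by (intro pack_matchings[OF assms(1,2)] matchings_subset[OF fac(1)]) (auto simp: \<D>_def)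
    moreover have "\<Union>{A, B, C} \<inter> \<Union>\<D> = {}"
      by (rule matchings_disjoint[OF fac(1,4)]) (auto simp: \<D>_def)
    then have "(A \<union> (B \<union> C)) \<inter> \<Union>\<D> = {}" by auto
    ultimately have "pack V ((A \<union> (B \<union> C)) \<union> \<Union>\<D>) (k + (k + 1) div 2 + (k - 2) * k)"
      using pack_Un[OF pack_ladder[OF ladder]] by blast
    moreover have "(A \<union> (B \<union> C)) \<union> \<Union>\<D> = nsets V 2"
      unfolding fac(3)[symmetric] \<D>_def using fac(4) by auto
    \<comment> \<open>Without \<open>W\<close> the ladder costs \<open>k\<close> more, but it also
      takes one pair of matchings more from the rest than the formula counts.\<close>
    moreover have "k + (k + 1) div 2 + (k - 2) * k = (k + 1) div 2 + (k - 1) * k"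
      using assms(3) by (cases k) (auto simp: algebra_simps numeral_2_eq_2 Suc_diff_le)
    ultimately have "pack V (nsets V 2) ((k + 1) div 2 + (k - 1) * k)" by (simp only:)
    then show ?thesis using True by simp
  next
    case False
    then obtain z where z: "z \<in> W" by blast
    then have zV: "z \<notin> V" using assms(5) by blast
    have base: "pack V (star z V \<union> (A \<union> (B \<union> C)) \<union> star z {}) ((k + 1) div 2)"
      using pack_star_ladder[OF ladder zV] by simp
    note aux = pack_small_outside_aux[OF assms(1,2,4,5,6) z _ _ fac]
    show ?thesis
    proof (cases "card W = 2 \<and> odd k")
      case True
      then obtain y where y: "W = {z, y}" "y \<noteq> z" using z by (auto simp: card_2_iff)
      have "pack V (star z V \<union> (A \<union> (B \<union> C)) \<union> star z {y}) ((k + 1) div 2)"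
        using pack_star_ladder_pendant[OF ladder zV _ y(2)[symmetric]] True y assms(5) by simp
      moreover have "pack {} (nsets W 2 - star z {y}) 0"
        unfolding y(1) nsets_2_eq by (auto simp: star_def intro: back_subst[of "\<lambda>E. pack {} E 0", OF pack_empty])
      ultimately show ?thesis using aux[of "{y}" 0] True y by auto
    next
      case nodd: False
      show ?thesis
      proof (cases "card W = 4 \<or> card W = 2")
        case True
        then have "pack {} (nsets W 2 - star z {}) 1" using complete_graph_excess_1[OF assms(4)] by auto
        then show ?thesis using aux[of "{}" 1] base True nodd by auto
      next
        case False
        then have "pack {} (nsets W 2 - star z {}) 0" using pack_complete_graph_not_2_4[OF assms(4)] by auto
        then show ?thesis using aux[of "{}" 0] base False by auto
      qed
    qed
  qed
qed

section \<open>The lower bound\<close>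

lemma cost_ON_le_cost_ON2: "cost_ON X 4 \<le> cost_ON2 X V 4 2"
proof -
  obtain P where "grooming2 X V 4 2 P" "drop_cost P = cost_ON2 X V 4 2"
    using cost_ON2_attained[of 4 2 X V] by auto
  then show ?thesis unfolding cost_ON_def grooming2_def by (intro Least_le) blast
qed

lemma cost_ON2_le_pack:
  assumes "pack V (nsets X 2) e"
  shows "cost_ON2 X V 4 2 \<le> card (nsets X 2) + e"
proof -
  obtain P where P: "partition_on (nsets X 2) P"
    "\<forall>B\<in>P. card B \<le> 4 \<and> card {x \<in> B. x \<subseteq> V} \<le> 2" "drop_cost P \<le> card (nsets X 2) + e"
    using assms unfolding pack_def by blast
  then have "cost_ON2 X V 4 2 \<le> drop_cost P"
    unfolding cost_ON2_def grooming2_def grooming_def by (intro Least_le) auto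
  then show ?thesis using P(3) by simp
qed

lemma choose_two_add: "(v + w) choose 2 = (v choose 2) + (w choose 2) + v * w"
  by (induction w) (simp_all add: numeral_2_eq_2)

lemma card_edges_le:
  assumes "finite U" "E \<subseteq> nsets U 2"
  shows "card E \<le> card U choose 2"
  using card_mono[OF finite_imp_finite_nsets[OF assms(1)] assms(2)] by (simp add: card_nsets)

text \<open>Up to three vertices span at most as many edges as there are vertices; from four on, the
  capacity is the bound.\<close>

lemma card_block_le_card_vertices:
  assumes "finite (\<Union>B)" "B \<subseteq> nsets X 2" "card B \<le> 4"
  shows "card B \<le> card (\<Union>B)"
proof -
  have "B \<subseteq> nsets (\<Union>B) 2" using assms(2) by (auto simp: nsets_def)
  from card_edges_le[OF assms(1) this] have le: "card B \<le> card (\<Union>B) choose 2" .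
  consider "card (\<Union>B) = 0" | "card (\<Union>B) = 1" | "card (\<Union>B) = 2" | "card (\<Union>B) = 3" | "card (\<Union>B) \<ge> 4"
    by linarith
  then show ?thesis using le assms(3) by cases (auto simp: choose_two)
qed

lemma grooming_finite:
  assumes "finite X" "grooming X C P"
  shows "finite P" "B \<in> P \<Longrightarrow> B \<subseteq> nsets X 2" "B \<in> P \<Longrightarrow> finite B" "B \<in> P \<Longrightarrow> finite (\<Union>B)"
proof -
  have P: "partition_on (nsets X 2) P" using assms(2) by (simp add: grooming_def)
  have fin: "finite (nsets X 2)" using assms(1) by (rule finite_imp_finite_nsets)
  show "finite P" by (rule finite_elements[OF fin P])
  show sub: "B \<subseteq> nsets X 2" if "B \<in> P" for B using partition_onD1[OF P] that by blast
  show "finite B" if "B \<in> P" using sub[OF that] fin by (rule finite_subset)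
  have "\<Union>B \<subseteq> X" if "B \<in> P" using sub[OF that] by (auto simp: nsets_def)
  then show "finite (\<Union>B)" if "B \<in> P" using assms(1) that finite_subset by blast
qed

lemma grooming_sum_edges:
  assumes "finite X" "grooming X C P"
  shows "(\<Sum>B\<in>P. card {e \<in> B. Q e}) = card {e \<in> nsets X 2. Q e}"
proof -
  have P: "partition_on (nsets X 2) P" using assms(2) by (simp add: grooming_def)
  have "{e \<in> nsets X 2. Q e} = (\<Union>B\<in>P. {e \<in> B. Q e})" using partition_onD1[OF P] by blast
  also have "card \<dots> = (\<Sum>B\<in>P. card {e \<in> B. Q e})"
  proof (rule card_UN_disjoint)
    show "\<forall>B\<in>P. \<forall>B'\<in>P. B \<noteq> B' \<longrightarrow> {e \<in> B. Q e} \<inter> {e \<in> B'. Q e} = {}"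
      using partition_onD2[OF P] unfolding disjoint_def by blast
  qed (use grooming_finite[OF assms] in auto)
  finally show ?thesis by simp
qed

lemma card_le_cost_ON:
  assumes "finite X"
  shows "card (nsets X 2) \<le> cost_ON X 4"
proof -
  obtain P where P: "grooming X 4 P" "drop_cost P = cost_ON X 4"
    using cost_ON_attained[of 4 X] by auto
  have "card (nsets X 2) = (\<Sum>B\<in>P. card B)"
    using grooming_sum_edges[OF assms P(1), of "\<lambda>_. True"] by simp
  also have "\<dots> \<le> drop_cost P"
    unfolding drop_cost_def using P(1) grooming_finite[OF assms P(1)]
    by (intro sum_mono card_block_le_card_vertices) (auto simp: grooming_def)
  finally show ?thesis using P(2) by simp
qed

text \<open>
  A block has \<open>a\<close> edges inside \<open>V\<close>, \<open>d\<close> inside \<open>W\<close>, \<open>b\<close> between them, and \<open>p\<close> and \<open>q\<close> vertices in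
  \<open>V\<close> and \<open>W\<close>.
\<close>

lemma block_arith:
  fixes a b d p q :: nat
  assumes "a + b + d \<le> p + q" "a + b + d \<le> 4" "a \<le> 2"
    "a \<ge> 1 \<Longrightarrow> p \<ge> 2" "a \<ge> 2 \<Longrightarrow> p \<ge> 3" "d \<ge> 1 \<Longrightarrow> q \<ge> 2" "d \<ge> 2 \<Longrightarrow> q \<ge> 3"
    "b \<ge> 1 \<Longrightarrow> p \<ge> 1" "b \<ge> 1 \<Longrightarrow> q \<ge> 1"
  shows "2 * (a + b + d) + a \<le> 2 * (p + q) + b"
    and "2 * (p + q) + b \<le> 2 * (a + b + d) + a + 1 \<Longrightarrow> d \<in> {0, 1, 3, 4} \<and> (d = 3 \<longrightarrow> q = 3)"
    and "2 * (p + q) + b \<le> 2 * (a + b + d) + a \<Longrightarrow> d \<noteq> 1"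
proof -
  have a: "a = 0 \<or> a = 1 \<or> a = 2" using assms(3) by linarith
  have b: "b = 0 \<or> b = 1 \<or> b = 2 \<or> b = 3 \<or> b = 4" using assms(2) by linarith
  have d: "d = 0 \<or> d = 1 \<or> d = 2 \<or> d = 3 \<or> d = 4" using assms(2) by linarith
  show "2 * (a + b + d) + a \<le> 2 * (p + q) + b"
    using a b d assms by (elim disjE) simp_all
  show "d \<in> {0, 1, 3, 4} \<and> (d = 3 \<longrightarrow> q = 3)" if "2 * (p + q) + b \<le> 2 * (a + b + d) + a + 1"
    using a b d assms that by (elim disjE) simp_all
  show "d \<noteq> 1" if "2 * (p + q) + b \<le> 2 * (a + b + d) + a"
    using a b d assms that by (elim disjE) simp_all
qed

section \<open>The slack of the blocks of a grooming\<close>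

context
  fixes X V W :: "'a set" and P :: "'a block set"
  assumes finX: "finite X" and X: "X = V \<union> W" and VW: "W \<inter> V = {}"
    and P: "grooming2 X V 4 2 P"
begin

definition inner :: "'a block \<Rightarrow> nat" where "inner B = card {e \<in> B. e \<subseteq> V}"
definition outer :: "'a block \<Rightarrow> nat" where "outer B = card {e \<in> B. e \<subseteq> W}"
definition mixed :: "'a block \<Rightarrow> nat" where "mixed B = card {e \<in> B. \<not> e \<subseteq> V \<and> \<not> e \<subseteq> W}"
text \<open>This is twice the gap in the inequality between the excess and
  \<open>(inner B - mixed B) / 2\<close>, doubled to stay in the natural numbers. The subtraction
  does not truncate on blocks of \<open>P\<close>, by the first part of
  \<open>block_bounds\<close>.\<close>

definition slack :: "'a block \<Rightarrow> nat" where
  "slack B = (2 * card (\<Union>B) + mixed B) - (2 * card B + inner B)"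

lemma gP: "grooming X 4 P"
  using P by (simp add: grooming2_def)

lemma card_block_split:
  assumes "B \<in> P"
  shows "card B = inner B + mixed B + outer B"
proof -
  note fin = grooming_finite[OF finX gP]
  have finB: "finite B" using fin(3)[OF assms] .
  have "{e \<in> B. e \<subseteq> V} \<inter> {e \<in> B. e \<subseteq> W} = {}"
    using fin(2)[OF assms] by (intro nsets_2_disjoint[OF VW]) (auto simp: nsets_def)
  then have "inner B + outer B = card ({e \<in> B. e \<subseteq> V} \<union> {e \<in> B. e \<subseteq> W})"
    using finB by (simp add: inner_def outer_def card_Un_disjoint)
  moreover have "card ({e \<in> B. e \<subseteq> V} \<union> {e \<in> B. e \<subseteq> W}) + mixed B =
      card (({e \<in> B. e \<subseteq> V} \<union> {e \<in> B. e \<subseteq> W}) \<union> {e \<in> B. \<not> e \<subseteq> V \<and> \<not> e \<subseteq> W})"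
    unfolding mixed_def using finB by (intro card_Un_disjoint[symmetric]) auto
  moreover have "({e \<in> B. e \<subseteq> V} \<union> {e \<in> B. e \<subseteq> W}) \<union> {e \<in> B. \<not> e \<subseteq> V \<and> \<not> e \<subseteq> W} = B" by blast
  ultimately show ?thesis by simp
qed

lemma block_bounds:
  assumes "B \<in> P"
  shows "2 * card B + inner B \<le> 2 * card (\<Union>B) + mixed B"
    and "slack B \<le> 1 \<Longrightarrow> outer B \<in> {0, 1, 3, 4} \<and> (outer B = 3 \<longrightarrow> card (\<Union>B \<inter> W) = 3)"
    and "slack B = 0 \<Longrightarrow> outer B \<noteq> 1"
proof -
  note fin = grooming_finite[OF finX gP]
  define p where "p = card (\<Union>B \<inter> V)"
  define q where "q = card (\<Union>B \<inter> W)"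
  have sub: "B \<subseteq> nsets X 2" using fin(2)[OF assms] .
  have fU: "finite (\<Union>B)" using fin(4)[OF assms] .
  have "\<Union>B = (\<Union>B \<inter> V) \<union> (\<Union>B \<inter> W)" using sub X by (auto simp: nsets_def)
  then have "card (\<Union>B) = card ((\<Union>B \<inter> V) \<union> (\<Union>B \<inter> W))" by simp
  also have "\<dots> = p + q"
    unfolding p_def q_def using fU VW by (intro card_Un_disjoint) auto
  finally have pq: "card (\<Union>B) = p + q" .
  have le: "card B \<le> 4" "inner B \<le> 2"
    using P assms by (auto simp: grooming2_def grooming_def inner_def)
  have "{e \<in> B. e \<subseteq> V} \<subseteq> nsets (\<Union>B \<inter> V) 2" "{e \<in> B. e \<subseteq> W} \<subseteq> nsets (\<Union>B \<inter> W) 2"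
    using sub by (auto simp: nsets_def)
  then have ch: "inner B \<le> p choose 2" "outer B \<le> q choose 2"
    unfolding inner_def outer_def p_def q_def using fU by (auto intro: card_edges_le)
  have chp: "r \<ge> 2" if "1 \<le> r choose 2" for r :: nat
    using that by (rule contrapos_pp) (simp add: binomial_eq_0)
  have chp': "r \<ge> 3" if "2 \<le> r choose 2" for r :: nat
  proof (rule ccontr)
    assume "\<not> 3 \<le> r"
    then have "r < 2 \<or> r = 2" by linarith
    then show False using that by (auto simp: binomial_eq_0)
  qed
  have mix: "1 \<le> p \<and> 1 \<le> q" if "mixed B \<ge> 1"
  proof -
    from that have "{e \<in> B. \<not> e \<subseteq> V \<and> \<not> e \<subseteq> W} \<noteq> {}" unfolding mixed_def by (metis card.empty not_one_le_zero)
    then obtain e where e: "e \<in> B" "\<not> e \<subseteq> V" "\<not> e \<subseteq> W" by blast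
    moreover have "e \<subseteq> V \<union> W" using e(1) sub X by (auto simp: nsets_def)
    ultimately have "\<Union>B \<inter> V \<noteq> {}" "\<Union>B \<inter> W \<noteq> {}" by blast+
    then show ?thesis using fU unfolding p_def q_def by (simp add: Suc_le_eq card_gt_0_iff)
  qed
  note split = card_block_split[OF assms]
  have h: "inner B + mixed B + outer B \<le> p + q" "inner B + mixed B + outer B \<le> 4" "inner B \<le> 2"
    "inner B \<ge> 1 \<Longrightarrow> p \<ge> 2" "inner B \<ge> 2 \<Longrightarrow> p \<ge> 3" "outer B \<ge> 1 \<Longrightarrow> q \<ge> 2" "outer B \<ge> 2 \<Longrightarrow> q \<ge> 3"
    "mixed B \<ge> 1 \<Longrightarrow> p \<ge> 1" "mixed B \<ge> 1 \<Longrightarrow> q \<ge> 1"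
    using card_block_le_card_vertices[OF fU sub le(1)] le mix
      order_trans[OF _ ch(1), THEN chp] order_trans[OF _ ch(1), THEN chp']
      order_trans[OF _ ch(2), THEN chp] order_trans[OF _ ch(2), THEN chp']
    unfolding pq split by blast+
  note ba = block_arith[OF h]
  show bd: "2 * card B + inner B \<le> 2 * card (\<Union>B) + mixed B"
    using ba(1) unfolding pq split .
  show "outer B \<in> {0, 1, 3, 4} \<and> (outer B = 3 \<longrightarrow> card (\<Union>B \<inter> W) = 3)" if "slack B \<le> 1"
  proof -
    have "2 * (p + q) + mixed B \<le> 2 * (inner B + mixed B + outer B) + inner B + 1"
      using that unfolding slack_def pq split by linarith
    then show ?thesis using ba(2) unfolding q_def by blast
  qed
  show "outer B \<noteq> 1" if "slack B = 0"
  proof -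
    have "2 * (p + q) + mixed B \<le> 2 * (inner B + mixed B + outer B) + inner B"
      using that unfolding slack_def pq split by linarith
    then show ?thesis using ba(3) by blast
  qed
qed

lemma sum_inner: "(\<Sum>B\<in>P. inner B) = card V choose 2"
  and sum_outer: "(\<Sum>B\<in>P. outer B) = card W choose 2"
  and sum_mixed: "(\<Sum>B\<in>P. mixed B) = card V * card W"
proof -
  have "{e \<in> nsets X 2. e \<subseteq> V} = nsets V 2" "{e \<in> nsets X 2. e \<subseteq> W} = nsets W 2"
    using X by (auto simp: nsets_def)
  then show i: "(\<Sum>B\<in>P. inner B) = card V choose 2" and o: "(\<Sum>B\<in>P. outer B) = card W choose 2"
    unfolding inner_def outer_def by (simp_all add: grooming_sum_edges[OF finX gP] card_nsets)
  have "card X = card V + card W" using finX X VW by (simp add: card_Un_disjoint Int_commute)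
  then have "(\<Sum>B\<in>P. card B) = (card V + card W) choose 2"
    using grooming_sum_edges[OF finX gP, of "\<lambda>_. True"] by (simp add: card_nsets)
  also have "(\<Sum>B\<in>P. card B) = (\<Sum>B\<in>P. inner B + mixed B + outer B)"
    by (intro sum.cong refl card_block_split)
  finally show "(\<Sum>B\<in>P. mixed B) = card V * card W"
    using i o by (simp add: sum.distrib choose_two_add)
qed

text \<open>As an identity, and not just a lower bound, this also determines the parity of the total
  slack.\<close>

lemma cost_slack:
  "2 * drop_cost P + card V * card W = 2 * card (nsets X 2) + (card V choose 2) + (\<Sum>B\<in>P. slack B)"
proof -
  have "(\<Sum>B\<in>P. 2 * card (\<Union>B) + mixed B) = (\<Sum>B\<in>P. 2 * card B + inner B + slack B)"
    using block_bounds(1) by (intro sum.cong) (auto simp: slack_def)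
  moreover have "(\<Sum>B\<in>P. card B) = card (nsets X 2)"
    using grooming_sum_edges[OF finX gP, of "\<lambda>_. True"] by simp
  ultimately show ?thesis
    by (simp add: sum.distrib sum_distrib_left[symmetric] drop_cost_def sum_inner sum_mixed)
qed

text \<open>Two triples in a set of four points share two points, and the edge joining these would
  lie in both blocks.\<close>

lemma two_triangles_in_K4:
  assumes "card W = 4" "B \<in> P" "B' \<in> P" "B \<noteq> B'" "outer B = 3" "outer B' = 3"
    "card (\<Union>B \<inter> W) = 3" "card (\<Union>B' \<inter> W) = 3"
  shows False
proof -
  have full: "nsets (\<Union>B \<inter> W) 2 \<subseteq> B" if "B \<in> P" "outer B = 3" "card (\<Union>B \<inter> W) = 3" for B
  proof -
    have "{e \<in> B. e \<subseteq> W} \<subseteq> nsets (\<Union>B \<inter> W) 2"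
      using grooming_finite(2)[OF finX gP that(1)] by (auto simp: nsets_def)
    moreover have "card (nsets (\<Union>B \<inter> W) 2) = 3" using that(3) by (simp add: card_nsets choose_two)
    moreover have "finite (nsets (\<Union>B \<inter> W) 2)"
      using grooming_finite(4)[OF finX gP that(1)] by (intro finite_imp_finite_nsets) blast
    ultimately have "{e \<in> B. e \<subseteq> W} = nsets (\<Union>B \<inter> W) 2"
      using that(2) by (intro card_subset_eq) (auto simp: outer_def)
    then show ?thesis by blast
  qed
  let ?S = "\<Union>B \<inter> W" and ?S' = "\<Union>B' \<inter> W"
  have fW: "finite W" using assms(1) by (simp add: card_ge_0_finite)
  then have "card (?S \<union> ?S') \<le> 4" unfolding assms(1)[symmetric] by (intro card_mono) auto
  moreover have "card ?S + card ?S' = card (?S \<union> ?S') + card (?S \<inter> ?S')"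
    using fW by (intro card_Un_Int) auto
  ultimately have "2 \<le> card (?S \<inter> ?S')" using assms(7,8) by linarith
  then obtain e where e: "e \<subseteq> ?S \<inter> ?S'" "card e = 2" using obtain_subset_with_card_n by metis
  then have "e \<in> nsets ?S 2" "e \<in> nsets ?S' 2" by (auto simp: nsets_def card_ge_0_finite)
  then have "e \<in> B" "e \<in> B'" using full[OF assms(2,5,7)] full[OF assms(3,6,8)] by auto
  then show False
    using P assms(2-4) by (auto simp: grooming2_def grooming_def partition_on_def disjoint_def)
qed

text \<open>
  With total slack at most \<open>1\<close>, the edges inside \<open>W\<close> would be distributed over blocks in numbers
  \<open>3\<close> or \<open>4\<close>, except for at most one block with a single such edge: impossible for \<open>K\<^sub>2\<close> and \<open>K\<^sub>4\<close>.
\<close>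

lemma slack_sum_ge_2:
  assumes "card W = 4 \<or> card W = 2 \<and> (\<Sum>B\<in>P. slack B) \<noteq> 1"
  shows "(\<Sum>B\<in>P. slack B) \<ge> 2"
proof (rule ccontr)
  assume "\<not> ?thesis"
  then have s1: "(\<Sum>B\<in>P. slack B) \<le> 1" by linarith
  have finP: "finite P" by (rule grooming_finite(1)[OF finX gP])
  have "slack B \<le> 1" if "B \<in> P" for B
    using s1 member_le_sum[OF that, of slack] finP by simp
  note bb = block_bounds(2)[OF _ this]
  define N where "N i = card {B \<in> P. outer B = i}" for i
  have "outer B = (if outer B = 1 then 1 else 0) + (if outer B = 3 then 3 else 0) + (if outer B = 4 then 4 else 0)"
    if "B \<in> P" for B
    using bb[OF that that] by auto
  then have "(\<Sum>B\<in>P. outer B) = (\<Sum>B\<in>P. (if outer B = 1 then 1 else 0) +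
      (if outer B = 3 then 3 else 0) + (if outer B = 4 then 4 else 0))"
    by (intro sum.cong) auto
  also have "\<dots> = N 1 + 3 * N 3 + 4 * N 4"
    using finP by (simp add: sum.distrib sum.If_cases N_def Int_def)
  finally have sum: "card W choose 2 = N 1 + 3 * N 3 + 4 * N 4" by (simp add: sum_outer)
  have N1: "N 1 \<le> (\<Sum>B\<in>P. slack B)"
  proof -
    have "N 1 = (\<Sum>B\<in>{B \<in> P. outer B = 1}. 1)" by (simp add: N_def)
    also have "\<dots> \<le> (\<Sum>B\<in>{B \<in> P. outer B = 1}. slack B)"
    proof (rule sum_mono)
      fix B assume "B \<in> {B \<in> P. outer B = 1}"
      then have "slack B \<noteq> 0" using block_bounds(3)[of B] by auto
      then show "1 \<le> slack B" by simp
    qed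
    also have "\<dots> \<le> (\<Sum>B\<in>P. slack B)" using finP by (intro sum_mono2) auto
    finally show ?thesis .
  qed
  show False
  proof (cases "card W = 4")
    case True
    then have "N 1 + 3 * N 3 + 4 * N 4 = 6" using sum by (simp add: choose_two)
    \<comment> \<open>With \<open>N 1\<close> at most one,
      \<open>6 = N 1 + 3 * N 3 + 4 * N 4\<close> has no other solution than two blocks with three
      edges.\<close>
    then have "N 3 = 2" using N1 s1 by presburger
    then obtain B B' where B: "{B \<in> P. outer B = 3} = {B, B'}" "B \<noteq> B'"
      unfolding N_def by (auto simp: card_2_iff)
    then have "B \<in> P" "B' \<in> P" "outer B = 3" "outer B' = 3" by auto
    then show False using two_triangles_in_K4[OF True, of B B'] B(2) bb by blast
  next
    case False
    \<comment> \<open>For \<open>card W = 2\<close> a total slack of one is excluded by hypothesis,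
      so it is zero and no block has exactly one edge in \<open>W\<close>. But \<open>1\<close> is
      not a sum of threes and fours.\<close>
    then have "N 1 + 3 * N 3 + 4 * N 4 = 1" "N 1 = 0" using sum N1 s1 assms by (auto simp: choose_two)
    then show False by presburger
  qed
qed

end

text \<open>The total slack has the parity of \<open>k\<close>. For odd \<open>k\<close> it is thus
  at least one, which accounts for the rounding; for even \<open>k\<close> it cannot be one, which
  is the case that \<open>slack_sum_ge_2\<close> leaves out for \<open>card W = 2\<close>.\<close>

lemma cost_ON2_lower:
  fixes V W :: "'a set"
  assumes "finite V" "card V = 2 * k" "finite W" "W \<inter> V = {}" "k \<ge> 1" "card W + 1 \<le> k"
  shows "card (nsets (V \<union> W) 2) + ((k + 1) div 2 + (k - 1 - card W) * k +
    (if card W = 4 \<or> card W = 2 \<and> even k then 1 else 0)) \<le> cost_ON2 (V \<union> W) V 4 2"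
proof -
  obtain P where P: "grooming2 (V \<union> W) V 4 2 P" "drop_cost P = cost_ON2 (V \<union> W) V 4 2"
    using cost_ON2_attained[of 4 2] by auto
  have finX: "finite (V \<union> W)" using assms(1,3) by simp
  note ctx = finX refl assms(4) P(1)
  define s where "s = (\<Sum>B\<in>P. slack V W B)"
  define N where "N = card (nsets (V \<union> W) 2)"
  define c where "c = cost_ON2 (V \<union> W) V 4 2"
  define w where "w = card W"
  \<comment> \<open>The number \<open>r\<close> counts the pairs of matchings left over in the
    construction, so both bounds contain \<open>r * k\<close>.\<close>
  obtain r where r: "k = Suc (w + r)" using assms(6) unfolding w_def by (metis add.commute le_Suc_ex plus_1_eq_Suc add_Suc)
  have ch: "(2 * k) choose 2 = k * (2 * k - 1)" by (simp add: choose_two)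
  have "2 * c + 2 * k * w = 2 * N + k * (2 * k - 1) + s"
    using cost_slack[OF ctx] unfolding P(2) s_def N_def c_def w_def assms(2) ch by simp
  moreover have "k * (2 * k - 1) = 2 * k * w + k + 2 * (r * k)"
    unfolding r by (simp add: algebra_simps)
  ultimately have cs: "2 * c = 2 * N + k + 2 * (r * k) + s" by linarith
  have s: "s \<ge> 2" if "w = 4 \<or> w = 2 \<and> s \<noteq> 1"
    using slack_sum_ge_2[OF ctx] that unfolding s_def w_def by simp
  have par: "even (k + s)" using cs by presburger
  have "N + ((k + 1) div 2 + r * k + (if w = 4 \<or> w = 2 \<and> even k then 1 else 0)) \<le> c"
  proof (cases "w = 4 \<or> w = 2 \<and> even k")
    case True
    then have "s \<ge> 2" using s par by auto
    \<comment> \<open>For odd \<open>k\<close> the slack is odd, hence at least three: one for the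
      rounding and two for the correction.\<close>
    then have "s \<ge> 2 + k mod 2" using par by presburger
    then show ?thesis unfolding if_P[OF True] using cs by presburger
  next
    case False
    then show ?thesis unfolding if_not_P[OF False] using cs by presburger
  qed
  moreover have "k - 1 - card W = r" using r by (simp add: w_def)
  ultimately show ?thesis unfolding N_def c_def w_def by simp
qed

text \<open>The binomial coefficient is \<open>k + 2 * (k - 1) * k\<close>, so only the half of
  \<open>k\<close> gets rounded.\<close>

lemma ceiling_half_choose:
  assumes "k \<ge> 1"
  shows "\<lceil>(1/2) * real ((2 * k) choose 2)\<rceil> = int ((k + 1) div 2 + (k - 1) * k)"
proof -
  obtain j where k: "k = Suc j" using assms by (metis Suc_le_D One_nat_def)
  have "(2 * k) choose 2 = k + 2 * (j * k)" unfolding k by (simp add: choose_two algebra_simps)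
  then have ch: "real ((2 * k) choose 2) = real k + 2 * real (j * k)" by simp
  have "2 * ((k + 1) div 2) = k + k mod 2" by presburger
  then have "real (2 * ((k + 1) div 2)) = real (k + k mod 2)" by (simp only:)
  then have h: "real ((k + 1) div 2 + (k - 1) * k) = (real k + real (k mod 2)) / 2 + real (j * k)"
    by (simp add: k)
  have m: "0 \<le> real (k mod 2)" "real (k mod 2) \<le> 1" by auto
  show ?thesis
  proof (rule ceiling_unique)
    show "real_of_int (int ((k + 1) div 2 + (k - 1) * k)) - 1 < 1 / 2 * real (2 * k choose 2)"
      unfolding of_int_of_nat_eq h ch using m by argo
    show "1 / 2 * real (2 * k choose 2) \<le> real_of_int (int ((k + 1) div 2 + (k - 1) * k))"
      unfolding of_int_of_nat_eq h ch using m by argo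
  qed
qed

theorem theorem4p1:
  fixes X V :: "'a set" and v w :: nat
  assumes "finite X" and "V \<subseteq> X" and "card V = v" and "card X = v + w"
    and "v + w \<ge> 5" and "even v"
  shows "(v \<le> 2 * w \<longrightarrow> cost_ON2 X V 4 2 = cost_ON X 4) \<and>
    (v \<ge> 2 * w + 2 \<longrightarrow>
      real (cost_ON2 X V 4 2) =
        real ((v + w) choose 2) + real_of_int \<lceil>(1/2) * real (v choose 2)\<rceil>
          - real v * real w / 2
          + (if w = 4 \<or> (w = 2 \<and> v mod 4 = 0) then 1 else 0))"
proof -
  define W where "W = X - V"
  have fin: "finite V" "finite W" using assms(1,2) by (auto simp: W_def intro: finite_subset)
  have XVW: "X = V \<union> W" "W \<inter> V = {}" using assms(2) by (auto simp: W_def)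
  have cW: "card W = w" using assms(2-4) fin(1) by (simp add: W_def card_Diff_subset)
  obtain k where v: "v = 2 * k" using assms(6) by (elim evenE)
  then have cV: "card V = 2 * k" using assms(3) by simp
  have cE: "card (nsets X 2) = (v + w) choose 2" using assms(4) by (simp add: card_nsets)
  have "cost_ON2 X V 4 2 = cost_ON X 4" if "v \<le> 2 * w"
  proof (rule antisym)
    have "pack V (nsets X 2) 0"
      unfolding XVW(1) using that v cW cV assms(5) by (intro pack_complete_graph_many_outside[OF fin(1) cV fin(2) XVW(2)]) auto
    from cost_ON2_le_pack[OF this] card_le_cost_ON[OF assms(1)]
    show "cost_ON2 X V 4 2 \<le> cost_ON X 4" by simp
  qed (rule cost_ON_le_cost_ON2)
  moreover have "real (cost_ON2 X V 4 2) =
        real ((v + w) choose 2) + real_of_int \<lceil>(1/2) * real (v choose 2)\<rceil>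
          - real v * real w / 2
          + (if w = 4 \<or> (w = 2 \<and> v mod 4 = 0) then 1 else 0)" if "v \<ge> 2 * w + 2"
  proof -
    have k: "w + 1 \<le> k" "k \<ge> 2" using that v assms(5) by linarith+
    define \<delta> where "\<delta> = (if w = 4 \<or> w = 2 \<and> even k then 1 else 0 :: nat)"
    have "cost_ON2 X V 4 2 = card (nsets X 2) + ((k + 1) div 2 + (k - 1 - w) * k + \<delta>)"
    proof (rule antisym)
      show "cost_ON2 X V 4 2 \<le> card (nsets X 2) + ((k + 1) div 2 + (k - 1 - w) * k + \<delta>)"
        using pack_complete_graph_small_outside[OF fin(1) cV k(2) fin(2) XVW(2)] k(1)
        unfolding cW XVW(1)[symmetric] \<delta>_def by (intro cost_ON2_le_pack) simp
      show "card (nsets X 2) + ((k + 1) div 2 + (k - 1 - w) * k + \<delta>) \<le> cost_ON2 X V 4 2"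
        using cost_ON2_lower[OF fin(1) cV fin(2) XVW(2)] k
        unfolding cW XVW(1)[symmetric] \<delta>_def by simp
    qed
    \<comment> \<open>The product \<open>w * k\<close> is the term \<open>v * w / 2\<close> of the
      formula; what remains is the ceiling computed in \<open>ceiling_half_choose\<close>.\<close>
    moreover have "(k - 1 - w) * k + w * k = (k - 1) * k"
    proof -
      have "k - 1 - w + w = k - 1" using k(1) by simp
      then show ?thesis by (metis add_mult_distrib)
    qed
    then have "real ((k - 1 - w) * k) + real (w * k) = real ((k - 1) * k)"
      by (simp only: of_nat_add[symmetric])
    then have "real ((k - 1 - w) * k) = real ((k - 1) * k) - real v * real w / 2"
      unfolding v by (simp add: mult.commute)
    moreover have "even k \<longleftrightarrow> v mod 4 = 0" unfolding v by presburger
    moreover have "real_of_int \<lceil>(1/2) * real (v choose 2)\<rceil> = real ((k + 1) div 2) + real ((k - 1) * k)"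
      unfolding v using ceiling_half_choose[of k] k(2) by simp
    ultimately show ?thesis unfolding cE \<delta>_def by simp
  qed
  ultimately show ?thesis by blast
qed

end
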